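(* Let $\Phi$, $\lambda$, $f$, $\mathcal D$ be as in the context. For $s>0$, $z>0$, $\tilde z>0$ define $R=\operatorname{acosh}\big(\frac{s^2}{2z\tilde z}+\frac12(\frac{z}{\tilde z}+\frac{\tilde z}{z})\big)$, $d=\sqrt{s^2+(z-\tilde z)^2\cosh^2 R}$, $r=z\sinh R$, $\tilde r=\tilde z\sinh R$, $c=z\cosh R$, $\tilde c=\tilde z\cosh R$, $h=\frac{(\tilde r-r+d)(r+\tilde r-d)}{2d}$, $\tilde h=\frac{(r-\tilde r+d)(r+\tilde r-d)}{2d}$, $\delta=\frac\pi2-\arcsin\frac{\tilde c-c}{d}$, $\tilde\delta=\frac\pi2-\arcsin\frac{c-\tilde c}{d}$, and $$\begin{aligned}F(s,z,\tilde z)={}&\pi\int_{-r}^{r}f(w+c)(r^2-w^2)\,dw+\pi\int_{-\tilde r}^{\tilde r}f(w+\tilde c)(\tilde r^2-w^2)\,dw\\&-\int_{r-h}^{r}\int_0^{2\pi}\int_0^{\sqrt{r^2-w^2}}f\big(c+w\cos\delta-\rho\cos\theta\sin\delta\big)\,\rho\,d\rho\,d\theta\,dw\\&-\int_{\tilde r-\tilde h}^{\tilde r}\int_0^{2\pi}\int_0^{\sqrt{\tilde r^2-w^2}}f\big(\tilde c+w\cos\tilde\delta-\rho\cos\theta\sin\tilde\delta\big)\,\rho\,d\rho\,d\theta\,dw.\end{aligned}$$ ($F$ does not depend on $\lambda$ or $\mathcal D$.) Then for any two distinct points $a=(x,y,z)$, $b=(\tilde x,\tilde y,\tilde z)$ of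 $\mathbb{H}^3$, the probability that $a\overset{\Phi\cup\{a,b\},\mathcal D}{\leftrightarrow}b$ (i.e. the two-fold Palm probability $\mathbb P^{a,b}(a\overset{\Phi,\mathcal D}{\leftrightarrow}b)$) equals $$e^{-\lambda F(d_E(a,b),z,\tilde z)}\,\mathbf 1_{\{(z,\tilde z)\in\mathcal D\}}.$$
   Context: $\mathbb{H}^3=\{(x,y,z)\in\mathbb{R}^3:z>0\}$; $d_E(a,b)=\sqrt{(x-\tilde x)^2+(y-\tilde y)^2}$; $d_{\mathbb{H}^3}(a,b)=\operatorname{acosh}\big(\frac{d_E(a,b)^2}{2z\tilde z}+\frac12(\frac{z}{\tilde z}+\frac{\tilde z}{z})\big)$. $\Phi$ is a Poisson point process on $\mathbb{R}^2\times(0,\infty)$ with intensity $\lambda\,dx\,dy\,f(z)\,dz$ ($\lambda>0$, $f$ a probability density on $(0,\infty)$), i.e. a homogeneous PPP of base-station positions with i.i.d. resource marks of density $f$. $\mathcal D\subset(0,\infty)^2$ is Borel and symmetric. Nearest neighbor relation: $a\xrightarrow{\phi}b$ if $b$ is the unique minimizer of $d_{\mathbb{H}^3}(a,\cdot)$ over $\phi\setminus\{a\}$. $a\overset{\phi,\mathcal D}{\leftrightarrow}b$ (MNNR$_{\mathbb{H}^3,\mathcal D}$) means $a\xrightarrow{\phi}b$, $b\xrightarrow{\phi}a$ and $(z,\tilde z)\in\mathcal D$ where $z,\tilde z$ are the marks of $a,b$. *)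

theory Defs
  imports "HOL-Probability.Probability"
begin

type_synonym pt = "real \<times> real \<times> real"

definition zc :: "pt \<Rightarrow> real" where "zc p = snd (snd p)"

definition H3 :: "pt set" where "H3 = {p. zc p > 0}"

definition dE :: "pt \<Rightarrow> pt \<Rightarrow> real" where
  "dE a b = sqrt ((fst a - fst b)\<^sup>2 + (fst (snd a) - fst (snd b))\<^sup>2)"

definition dH3 :: "pt \<Rightarrow> pt \<Rightarrow> real" where
  "dH3 a b = arcosh ((dE a b)\<^sup>2 / (2 * zc a * zc b) + (zc a / zc b + zc b / zc a) / 2)"

definition nn_rel :: "pt set \<Rightarrow> pt \<Rightarrow> pt \<Rightarrow> bool" where
  "nn_rel \<phi> a b \<longleftrightarrow> is_arg_min (dH3 a) (\<lambda>c. c \<in> \<phi> - {a}) b \<and>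
     (\<forall>c. is_arg_min (dH3 a) (\<lambda>c. c \<in> \<phi> - {a}) c \<longrightarrow> c = b)"

definition mnnr :: "(real \<times> real) set \<Rightarrow> pt set \<Rightarrow> pt \<Rightarrow> pt \<Rightarrow> bool" where
  "mnnr D \<phi> a b \<longleftrightarrow> nn_rel \<phi> a b \<and> nn_rel \<phi> b a \<and> (zc a, zc b) \<in> D"

definition PPP_intensity :: "real \<Rightarrow> (real \<Rightarrow> real) \<Rightarrow> pt measure" where
  "PPP_intensity lam f = density lborel (\<lambda>p. if zc p > 0 then ennreal (lam * f (zc p)) else 0)"

definition poisson_process :: "'w measure \<Rightarrow> ('w \<Rightarrow> pt set) \<Rightarrow> pt measure \<Rightarrow> bool" where
  "poisson_process M \<Phi> \<mu> \<longleftrightarrow> prob_space M \<and>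
     (\<forall>\<omega>\<in>space M. \<forall>K. bounded K \<longrightarrow> finite (\<Phi> \<omega> \<inter> K)) \<and>
     (\<forall>A\<in>sets \<mu>. emeasure \<mu> A < \<infinity> \<longrightarrow>
        (AE \<omega> in M. finite (\<Phi> \<omega> \<inter> A)) \<and>
        (\<lambda>\<omega>. card (\<Phi> \<omega> \<inter> A)) \<in> measurable M (count_space UNIV) \<and>
        (\<forall>k::nat. measure M {\<omega>\<in>space M. card (\<Phi> \<omega> \<inter> A) = k} =
            measure \<mu> A ^ k / fact k * exp (- measure \<mu> A))) \<and>
     (\<forall>(I::nat set) A. finite I \<longrightarrow> (\<forall>i\<in>I. A i \<in> sets \<mu> \<and> emeasure \<mu> (A i) < \<infinity>) \<longrightarrow>
        disjoint_family_on A I \<longrightarrow>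
        prob_space.indep_vars M (\<lambda>_. count_space UNIV) (\<lambda>i \<omega>. card (\<Phi> \<omega> \<inter> A i)) I)"

definition Rf :: "real \<Rightarrow> real \<Rightarrow> real \<Rightarrow> real" where
  "Rf s z z' = arcosh (s\<^sup>2 / (2 * z * z') + (z / z' + z' / z) / 2)"

definition F :: "(real \<Rightarrow> real) \<Rightarrow> real \<Rightarrow> real \<Rightarrow> real \<Rightarrow> real" where
  "F f s z z' =
    (let R = Rf s z z';
         d = sqrt (s\<^sup>2 + (z - z')\<^sup>2 * (cosh R)\<^sup>2);
         r = z * sinh R; r' = z' * sinh R;
         c = z * cosh R; c' = z' * cosh R;
         h = (r' - r + d) * (r + r' - d) / (2 * d);
         h' = (r - r' + d) * (r + r' - d) / (2 * d);
         \<delta> = pi / 2 - arcsin ((c' - c) / d);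
         \<delta>' = pi / 2 - arcsin ((c - c') / d)
     in pi * (LBINT w=-r..r. f (w + c) * (r\<^sup>2 - w\<^sup>2))
      + pi * (LBINT w=-r'..r'. f (w + c') * (r'\<^sup>2 - w\<^sup>2))
      - (LBINT w=r-h..r. (LBINT \<theta>=0..2*pi. (LBINT \<rho>=0..sqrt (r\<^sup>2 - w\<^sup>2).
           f (c + w * cos \<delta> - \<rho> * cos \<theta> * sin \<delta>) * \<rho>)))
      - (LBINT w=r'-h'..r'. (LBINT \<theta>=0..2*pi. (LBINT \<rho>=0..sqrt (r'\<^sup>2 - w\<^sup>2).
           f (c' + w * cos \<delta>' - \<rho> * cos \<theta> * sin \<delta>') * \<rho>))))"

end

theory Submission
  imports Defs
begin

text \<open>
  The pair is mutually nearest iff the process has no point in the union of the two closed hyperbolic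
  balls of radius \<open>R = dH3 a b\<close> around \<open>a\<close> and \<open>b\<close>, so the probability is the exponential of minus the
  intensity of that union. These balls are Euclidean balls with centres at heights \<open>z cosh R\<close>,
  \<open>z' cosh R\<close> and radii \<open>z sinh R\<close>, \<open>z' sinh R\<close>. Their spheres meet, because \<open>d\<^sup>2 - (r - r')\<^sup>2 =
  2 z z' (cosh R - 1)\<close> and \<open>(r + r')\<^sup>2 - d\<^sup>2 = 2 z z' (2 cosh R + 1) (cosh R - 1)\<close> are positive;
  hence the radical plane cuts the intersection into one cap of each ball, and inclusion-exclusion
  gives the four terms of \<open>F\<close>. A cap is integrated in cylindrical coordinates around the line
  through the two centres: two plane rotations align the axes, and since the integrand only depends on
  \<open>\<rho> cos \<theta>\<close>, polar coordinates reduce to two one-dimensional substitutions.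
\<close>

subsection \<open>Rotations and polar coordinates\<close>

lemma nn_integral_lborel_swap:
  fixes G :: "real \<Rightarrow> real \<Rightarrow> ennreal"
  assumes [measurable]: "(\<lambda>(x, y). G x y) \<in> borel_measurable (borel \<Otimes>\<^sub>M borel)"
  shows "(\<integral>\<^sup>+x. \<integral>\<^sup>+y. G x y \<partial>lborel \<partial>lborel) = (\<integral>\<^sup>+y. \<integral>\<^sup>+x. G x y \<partial>lborel \<partial>lborel)"
  by (rule lborel_pair.Fubini'[symmetric]) simp

text \<open>For nonzero \<open>c\<close> the rotation factors into two one-dimensional affine
  substitutions: first \<open>u = c * x - s * y\<close> at fixed \<open>y\<close>, contributing
  1/|c|, then the second coordinate at fixed \<open>u\<close>, contributing |c|. For
  \<open>c = 0\<close> the rotation merely exchanges the coordinates up to signs.\<close>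

lemma nn_integral_lborel_rotation:
  fixes G :: "real \<Rightarrow> real \<Rightarrow> ennreal"
  assumes [measurable]: "(\<lambda>(x, y). G x y) \<in> borel_measurable (borel \<Otimes>\<^sub>M borel)"
    and cs: "c\<^sup>2 + s\<^sup>2 = 1"
  shows "(\<integral>\<^sup>+x. \<integral>\<^sup>+y. G x y \<partial>lborel \<partial>lborel) =
    (\<integral>\<^sup>+x. \<integral>\<^sup>+y. G (c * x - s * y) (s * x + c * y) \<partial>lborel \<partial>lborel)"
proof (cases "c = 0")
  case True
  with cs have s: "\<bar>s\<bar> = 1" by (simp add: abs_square_eq_1)
  then have s0: "s \<noteq> 0" by auto
  have "(\<integral>\<^sup>+x. \<integral>\<^sup>+y. G (c * x - s * y) (s * x + c * y) \<partial>lborel \<partial>lborel)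
      = (\<integral>\<^sup>+y. \<integral>\<^sup>+x. G (- s * y) (s * x) \<partial>lborel \<partial>lborel)"
    using True by (subst nn_integral_lborel_swap) simp_all
  also have "\<dots> = (\<integral>\<^sup>+y. \<integral>\<^sup>+v. G (- s * y) v \<partial>lborel \<partial>lborel)"
  proof (rule nn_integral_cong)
    fix y
    show "(\<integral>\<^sup>+x. G (- s * y) (s * x) \<partial>lborel) = (\<integral>\<^sup>+v. G (- s * y) v \<partial>lborel)"
      by (subst (2) nn_integral_real_affine[where c = s and t = 0]) (use s s0 in simp_all)
  qed
  also have "\<dots> = (\<integral>\<^sup>+u. \<integral>\<^sup>+v. G u v \<partial>lborel \<partial>lborel)"
    by (subst (2) nn_integral_real_affine[where c = "- s" and t = 0]) (use s s0 in simp_all)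
  finally show ?thesis by simp
next
  case False
  \<comment> \<open>Solving \<open>u = c * x - s * y\<close> for \<open>x\<close> turns the second
    coordinate \<open>s * x + c * y\<close> into \<open>(s * u + y) / c\<close>, by
    \<open>c\<^sup>2 + s\<^sup>2 = 1\<close>.\<close>
  have eq: "s * (s * y / c + 1 / c * u) + c * y = s * u / c + 1 / c * y" for u y
  proof -
    have "s * (s * y / c + 1 / c * u) + c * y = s * u / c + (c\<^sup>2 + s\<^sup>2) * y / c"
      using False by (simp add: field_simps power2_eq_square)
    then show ?thesis by (simp add: cs)
  qed
  have "(\<integral>\<^sup>+x. \<integral>\<^sup>+y. G (c * x - s * y) (s * x + c * y) \<partial>lborel \<partial>lborel)
      = (\<integral>\<^sup>+y. \<integral>\<^sup>+x. G (c * x - s * y) (s * x + c * y) \<partial>lborel \<partial>lborel)"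
    by (subst nn_integral_lborel_swap) simp_all
  also have "\<dots> = (\<integral>\<^sup>+y. \<integral>\<^sup>+u. ennreal \<bar>1 / c\<bar> * G u (s * u / c + 1 / c * y) \<partial>lborel \<partial>lborel)"
  proof (rule nn_integral_cong)
    fix y
    have "(\<integral>\<^sup>+x. G (c * x - s * y) (s * x + c * y) \<partial>lborel) = ennreal \<bar>1 / c\<bar> *
       (\<integral>\<^sup>+u. G (c * (s * y / c + 1 / c * u) - s * y) (s * (s * y / c + 1 / c * u) + c * y) \<partial>lborel)"
      by (rule nn_integral_real_affine) (use False in simp_all)
    also have "\<dots> = ennreal \<bar>1 / c\<bar> * (\<integral>\<^sup>+u. G u (s * u / c + 1 / c * y) \<partial>lborel)"
      unfolding eq using False by (simp add: field_simps)
    finally show "(\<integral>\<^sup>+x. G (c * x - s * y) (s * x + c * y) \<partial>lborel) =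
       (\<integral>\<^sup>+u. ennreal \<bar>1 / c\<bar> * G u (s * u / c + 1 / c * y) \<partial>lborel)"
      by (simp add: nn_integral_cmult)
  qed
  also have "\<dots> = (\<integral>\<^sup>+u. \<integral>\<^sup>+y. ennreal \<bar>1 / c\<bar> * G u (s * u / c + 1 / c * y) \<partial>lborel \<partial>lborel)"
    by (rule nn_integral_lborel_swap) simp
  also have "\<dots> = (\<integral>\<^sup>+u. \<integral>\<^sup>+v. G u v \<partial>lborel \<partial>lborel)"
  proof (rule nn_integral_cong)
    fix u
    have "(\<integral>\<^sup>+v. G u v \<partial>lborel) = ennreal \<bar>1 / c\<bar> * (\<integral>\<^sup>+y. G u (s * u / c + 1 / c * y) \<partial>lborel)"
      by (rule nn_integral_real_affine) (use False in simp_all)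
    then show "(\<integral>\<^sup>+y. ennreal \<bar>1 / c\<bar> * G u (s * u / c + 1 / c * y) \<partial>lborel) = (\<integral>\<^sup>+v. G u v \<partial>lborel)"
      by (simp add: nn_integral_cmult)
  qed
  finally show ?thesis by simp
qed

lemma nn_integral_lborel3:
  fixes H :: "real \<times> real \<times> real \<Rightarrow> ennreal"
  assumes [measurable]: "H \<in> borel_measurable borel"
  shows "(\<integral>\<^sup>+p. H p \<partial>lborel) = (\<integral>\<^sup>+x. \<integral>\<^sup>+y. \<integral>\<^sup>+z. H (x, y, z) \<partial>lborel \<partial>lborel \<partial>lborel)"
proof -
  have m: "H \<in> borel_measurable (lborel \<Otimes>\<^sub>M lborel)"
    by (simp add: lborel_prod)
  have m2: "(\<lambda>q. H (x, q)) \<in> borel_measurable (lborel \<Otimes>\<^sub>M lborel)" for x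
    by (simp add: lborel_prod)
  have "(\<integral>\<^sup>+p. H p \<partial>lborel) = (\<integral>\<^sup>+x. \<integral>\<^sup>+q. H (x, q) \<partial>lborel \<partial>lborel)"
    using lborel.nn_integral_fst[OF m] by (simp add: lborel_prod)
  also have "\<dots> = (\<integral>\<^sup>+x. \<integral>\<^sup>+y. \<integral>\<^sup>+z. H (x, y, z) \<partial>lborel \<partial>lborel \<partial>lborel)"
    by (intro nn_integral_cong) (use lborel.nn_integral_fst[OF m2] in \<open>simp add: lborel_prod\<close>)
  finally show ?thesis .
qed

text \<open>The new axes are \<open>(\<sigma> e, \<kappa>)\<close>, \<open>(\<kappa> e, -\<sigma>)\<close> and the horizontal normal of \<open>e\<close>.\<close>

lemma nn_integral_lborel3_orthonormal:
  fixes H :: "real \<times> real \<times> real \<Rightarrow> ennreal"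
  assumes [measurable]: "H \<in> borel_measurable borel"
    and e: "e1\<^sup>2 + e2\<^sup>2 = 1" and sk: "\<kappa>\<^sup>2 + \<sigma>\<^sup>2 = 1"
  shows "(\<integral>\<^sup>+p. H p \<partial>lborel) = (\<integral>\<^sup>+w. \<integral>\<^sup>+v. \<integral>\<^sup>+y.
     H (x0 + (e1 * (\<sigma> * w + \<kappa> * v) - e2 * y), y0 + (e2 * (\<sigma> * w + \<kappa> * v) + e1 * y),
        c + (\<kappa> * w - \<sigma> * v)) \<partial>lborel \<partial>lborel \<partial>lborel)"
proof -
  have transl: "(\<integral>\<^sup>+z. k z \<partial>lborel) = (\<integral>\<^sup>+z. k (t + z) \<partial>lborel)"
    if "k \<in> borel_measurable borel" for k :: "real \<Rightarrow> ennreal" and t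
    using nn_integral_real_affine[of k 1 t] that by simp
  let ?H' = "\<lambda>x y z. H (x0 + x, y0 + y, c + z)"
  have "(\<integral>\<^sup>+p. H p \<partial>lborel) = (\<integral>\<^sup>+x. \<integral>\<^sup>+y. \<integral>\<^sup>+z. H (x, y, z) \<partial>lborel \<partial>lborel \<partial>lborel)"
    by (rule nn_integral_lborel3) simp
  also have "\<dots> = (\<integral>\<^sup>+x. \<integral>\<^sup>+y. \<integral>\<^sup>+z. H (x0 + x, y, z) \<partial>lborel \<partial>lborel \<partial>lborel)"
    by (rule transl) simp
  also have "\<dots> = (\<integral>\<^sup>+x. \<integral>\<^sup>+y. \<integral>\<^sup>+z. H (x0 + x, y0 + y, z) \<partial>lborel \<partial>lborel \<partial>lborel)"
    by (rule nn_integral_cong, rule transl) simp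
  also have "\<dots> = (\<integral>\<^sup>+x. \<integral>\<^sup>+y. \<integral>\<^sup>+z. ?H' x y z \<partial>lborel \<partial>lborel \<partial>lborel)"
    by (rule nn_integral_cong, rule nn_integral_cong, rule transl) simp
  \<comment> \<open>First rotation, in the horizontal plane: afterwards \<open>x\<close> is the
    coordinate along \<open>(e1, e2)\<close> and \<open>y\<close> the one along its horizontal
    normal.\<close>
  also have "\<dots> = (\<integral>\<^sup>+x. \<integral>\<^sup>+y. \<integral>\<^sup>+z. ?H' (e1 * x - e2 * y) (e2 * x + e1 * y) z \<partial>lborel \<partial>lborel \<partial>lborel)"
    by (rule nn_integral_lborel_rotation) (use e in simp_all)
  also have "\<dots> = (\<integral>\<^sup>+y. \<integral>\<^sup>+x. \<integral>\<^sup>+z. ?H' (e1 * x - e2 * y) (e2 * x + e1 * y) z \<partial>lborel \<partial>lborel \<partial>lborel)"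
    by (rule nn_integral_lborel_swap) simp
  \<comment> \<open>Second rotation, in the vertical plane through \<open>(e1, e2)\<close>; the sine
    is taken as \<open>- \<sigma>\<close> so that increasing \<open>w\<close> moves in the direction
    with vertical component \<kappa>. The exchanges that follow only bring \<open>w\<close>
    outermost and \<open>y\<close> innermost.\<close>
  also have "\<dots> = (\<integral>\<^sup>+y. \<integral>\<^sup>+v. \<integral>\<^sup>+w. ?H' (e1 * (\<kappa> * v - (- \<sigma>) * w) - e2 * y)
      (e2 * (\<kappa> * v - (- \<sigma>) * w) + e1 * y) ((- \<sigma>) * v + \<kappa> * w) \<partial>lborel \<partial>lborel \<partial>lborel)"
    by (rule nn_integral_cong, rule nn_integral_lborel_rotation) (use sk in simp_all)
  also have "\<dots> = (\<integral>\<^sup>+y. \<integral>\<^sup>+w. \<integral>\<^sup>+v. ?H' (e1 * (\<kappa> * v - (- \<sigma>) * w) - e2 * y)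
      (e2 * (\<kappa> * v - (- \<sigma>) * w) + e1 * y) ((- \<sigma>) * v + \<kappa> * w) \<partial>lborel \<partial>lborel \<partial>lborel)"
    by (rule nn_integral_cong, rule nn_integral_lborel_swap) simp
  also have "\<dots> = (\<integral>\<^sup>+w. \<integral>\<^sup>+y. \<integral>\<^sup>+v. ?H' (e1 * (\<kappa> * v - (- \<sigma>) * w) - e2 * y)
      (e2 * (\<kappa> * v - (- \<sigma>) * w) + e1 * y) ((- \<sigma>) * v + \<kappa> * w) \<partial>lborel \<partial>lborel \<partial>lborel)"
    by (rule nn_integral_lborel_swap) simp
  also have "\<dots> = (\<integral>\<^sup>+w. \<integral>\<^sup>+v. \<integral>\<^sup>+y. ?H' (e1 * (\<kappa> * v - (- \<sigma>) * w) - e2 * y)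
      (e2 * (\<kappa> * v - (- \<sigma>) * w) + e1 * y) ((- \<sigma>) * v + \<kappa> * w) \<partial>lborel \<partial>lborel \<partial>lborel)"
    by (rule nn_integral_cong, rule nn_integral_lborel_swap) simp
  finally show ?thesis
    by (simp add: add.commute[of "\<kappa> * _"])
qed

text \<open>The substitution is \<open>x = - \<rho> * cos \<theta>\<close>, for which dx = \<rho>
  sin \<theta> d\<theta> and sqrt(\<rho>^2 - x^2) = \<rho> sin \<theta>. A preliminary reflection of
  \<open>x\<close> supplies the minus sign, which makes the map increasing on \<open>{0..pi}\<close>
  as the substitution rule demands.\<close>

lemma nn_integral_semicircle:
  fixes k :: "real \<Rightarrow> ennreal"
  assumes [measurable]: "k \<in> borel_measurable borel" and \<rho>: "0 < \<rho>"
  shows "(\<integral>\<^sup>+\<theta>. k (\<rho> * cos \<theta>) * ennreal \<rho> * indicator {0..pi} \<theta> \<partial>lborel) =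
    (\<integral>\<^sup>+x. k x * ennreal (\<rho> / sqrt (\<rho>\<^sup>2 - x\<^sup>2)) * indicator {-\<rho>..\<rho>} x \<partial>lborel)"
proof -
  let ?f = "\<lambda>x. k (- x) * ennreal (\<rho> / sqrt (\<rho>\<^sup>2 - x\<^sup>2))"
  have "(\<integral>\<^sup>+x. k x * ennreal (\<rho> / sqrt (\<rho>\<^sup>2 - x\<^sup>2)) * indicator {-\<rho>..\<rho>} x \<partial>lborel)
      = (\<integral>\<^sup>+x. ?f x * indicator {-\<rho>..\<rho>} x \<partial>lborel)"
    by (subst nn_integral_real_affine[where c = "-1" and t = 0])
       (auto intro!: nn_integral_cong split: split_indicator)
  also have "\<dots> = (\<integral>\<^sup>+x. ?f x * indicator {- \<rho> * cos 0..- \<rho> * cos pi} x \<partial>lborel)"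
    by simp
  also have "\<dots> = (\<integral>\<^sup>+\<theta>. ?f (- \<rho> * cos \<theta>) * ennreal (\<rho> * sin \<theta>) * indicator {0..pi} \<theta> \<partial>lborel)"
    by (rule nn_integral_substitution_aux)
       (use \<rho> in \<open>auto intro!: derivative_eq_intros continuous_intros sin_ge_zero mult_nonneg_nonneg\<close>)
  also have "\<dots> = (\<integral>\<^sup>+\<theta>. k (\<rho> * cos \<theta>) * ennreal \<rho> * indicator {0..pi} \<theta> \<partial>lborel)"
  proof (rule nn_integral_cong_AE)
    \<comment> \<open>At 0 and \<open>pi\<close> the sine vanishes and the left integrand collapses
      to 0, division by zero being 0, so the two sides may differ at these two points.\<close>
    show "AE \<theta> in lborel. ?f (- \<rho> * cos \<theta>) * ennreal (\<rho> * sin \<theta>) * indicator {0..pi} \<theta> =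
        k (\<rho> * cos \<theta>) * ennreal \<rho> * indicator {0..pi} \<theta>"
      using AE_lborel_singleton[of 0] AE_lborel_singleton[of pi]
    proof eventually_elim
      fix \<theta> :: real assume ne: "\<theta> \<noteq> 0" "\<theta> \<noteq> pi"
      show "?f (- \<rho> * cos \<theta>) * ennreal (\<rho> * sin \<theta>) * indicator {0..pi} \<theta> =
        k (\<rho> * cos \<theta>) * ennreal \<rho> * indicator {0..pi} \<theta>"
      proof (cases "\<theta> \<in> {0..pi}")
        case True
        with ne have s: "sin \<theta> > 0" by (intro sin_gt_zero) auto
        have "\<rho>\<^sup>2 - (- \<rho> * cos \<theta>)\<^sup>2 = (\<rho> * sin \<theta>)\<^sup>2"
          by (simp add: power_mult_distrib sin_squared_eq algebra_simps)
        then have "sqrt (\<rho>\<^sup>2 - (- \<rho> * cos \<theta>)\<^sup>2) = \<rho> * sin \<theta>"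
          using s \<rho> by simp
        then have "ennreal (\<rho> / sqrt (\<rho>\<^sup>2 - (- \<rho> * cos \<theta>)\<^sup>2)) * ennreal (\<rho> * sin \<theta>) = ennreal \<rho>"
          using s \<rho> by (subst ennreal_mult[symmetric]) (simp_all)
        then show ?thesis by (simp add: mult.assoc)
      qed simp
    qed
  qed
  finally show ?thesis by simp
qed

text \<open>The reflection of \<theta> to 2 pi - \<theta> preserves the cosine and maps the lower
  half circle onto the upper one.\<close>

lemma nn_integral_full_circle:
  fixes k :: "real \<Rightarrow> ennreal"
  assumes [measurable]: "k \<in> borel_measurable borel"
  shows "(\<integral>\<^sup>+\<theta>. k (cos \<theta>) * indicator {0..2*pi} \<theta> \<partial>lborel) =
    2 * (\<integral>\<^sup>+\<theta>. k (cos \<theta>) * indicator {0..pi} \<theta> \<partial>lborel)"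
proof -
  have "(\<integral>\<^sup>+\<theta>. k (cos \<theta>) * indicator {0..2*pi} \<theta> \<partial>lborel) =
     (\<integral>\<^sup>+\<theta>. k (cos \<theta>) * indicator {0..pi} \<theta> + k (cos \<theta>) * indicator {pi..2*pi} \<theta> \<partial>lborel)"
    by (rule nn_integral_cong_AE, use AE_lborel_singleton[of pi] in eventually_elim)
       (auto split: split_indicator)
  also have "\<dots> = (\<integral>\<^sup>+\<theta>. k (cos \<theta>) * indicator {0..pi} \<theta> \<partial>lborel) +
      (\<integral>\<^sup>+\<theta>. k (cos \<theta>) * indicator {pi..2*pi} \<theta> \<partial>lborel)"
    by (rule nn_integral_add) simp_all
  also have "(\<integral>\<^sup>+\<theta>. k (cos \<theta>) * indicator {pi..2*pi} \<theta> \<partial>lborel) =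
     (\<integral>\<^sup>+\<theta>. k (cos \<theta>) * indicator {0..pi} \<theta> \<partial>lborel)"
  proof -
    have "(\<integral>\<^sup>+\<theta>. k (cos \<theta>) * indicator {pi..2*pi} \<theta> \<partial>lborel) = ennreal \<bar>-1\<bar> *
      (\<integral>\<^sup>+\<theta>. k (cos (2*pi + (-1) * \<theta>)) * indicator {pi..2*pi} (2*pi + (-1) * \<theta>) \<partial>lborel)"
      by (rule nn_integral_real_affine) simp_all
    also have "\<dots> = (\<integral>\<^sup>+\<theta>. k (cos (2*pi + (-1) * \<theta>)) * indicator {pi..2*pi} (2*pi + (-1) * \<theta>) \<partial>lborel)"
      by simp
    also have "\<dots> = (\<integral>\<^sup>+\<theta>. k (cos \<theta>) * indicator {0..pi} \<theta> \<partial>lborel)"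
    proof (rule nn_integral_cong)
      fix \<theta> :: real
      have "cos (2*pi + (-1) * \<theta>) = cos \<theta>" by (simp add: cos_diff)
      moreover have "2*pi + (-1) * \<theta> \<in> {pi..2*pi} \<longleftrightarrow> \<theta> \<in> {0..pi}" by auto
      ultimately show "k (cos (2*pi + (-1) * \<theta>)) * indicator {pi..2*pi} (2*pi + (-1) * \<theta>) =
          k (cos \<theta>) * indicator {0..pi} \<theta>"
        by (simp only: indicator_def)
    qed
    finally show ?thesis .
  qed
  finally show ?thesis by (simp only: mult_2)
qed

text \<open>Substituting \<rho> = sqrt(u^2 + x^2) absorbs the singularity at \<rho> = |x|: the
  integrand becomes 1 on \<open>{0..B}\<close>. Since \<open>x\<close> is nonzero, the substitution
  is smooth up to u = 0.\<close>

lemma nn_integral_radial: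
  fixes x A :: real
  assumes x: "x \<noteq> 0" "\<bar>x\<bar> < A"
  shows "(\<integral>\<^sup>+\<rho>. ennreal (\<rho> / sqrt (\<rho>\<^sup>2 - x\<^sup>2)) * indicator {\<bar>x\<bar>..A} \<rho> \<partial>lborel) =
    ennreal (sqrt (A\<^sup>2 - x\<^sup>2))"
proof -
  define B where "B = sqrt (A\<^sup>2 - x\<^sup>2)"
  have "x\<^sup>2 < A\<^sup>2" using x by (metis abs_ge_zero power2_abs power_strict_mono zero_less_numeral)
  then have B: "B > 0" and B2: "B\<^sup>2 = A\<^sup>2 - x\<^sup>2" by (simp_all add: B_def)
  let ?g = "\<lambda>u. sqrt (u\<^sup>2 + x\<^sup>2)"
  have pos: "u\<^sup>2 + x\<^sup>2 > 0" for u using x by (simp add: add_nonneg_pos)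
  have g: "?g 0 = \<bar>x\<bar>" "?g B = A" using x B2 by simp_all
  have "(\<integral>\<^sup>+\<rho>. ennreal (\<rho> / sqrt (\<rho>\<^sup>2 - x\<^sup>2)) * indicator {?g 0..?g B} \<rho> \<partial>lborel) =
    (\<integral>\<^sup>+u. ennreal (?g u / sqrt ((?g u)\<^sup>2 - x\<^sup>2)) * ennreal (u / ?g u) * indicator {0..B} u \<partial>lborel)"
  proof (rule nn_integral_substitution_aux)
    show "((\<lambda>u. sqrt (u\<^sup>2 + x\<^sup>2)) has_real_derivative u / sqrt (u\<^sup>2 + x\<^sup>2)) (at u)" for u
      using pos[of u] by (auto intro!: derivative_eq_intros simp: field_simps)
    show "continuous_on {0..B} (\<lambda>u. u / sqrt (u\<^sup>2 + x\<^sup>2))"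
      using pos by (intro continuous_intros) (auto simp: less_imp_neq[symmetric] x)
  qed (use B in simp_all)
  also have "\<dots> = (\<integral>\<^sup>+u. indicator {0..B} u \<partial>lborel)"
  proof (rule nn_integral_cong_AE, use AE_lborel_singleton[of 0] in eventually_elim)
    fix u :: real assume u: "u \<noteq> 0"
    show "ennreal (?g u / sqrt ((?g u)\<^sup>2 - x\<^sup>2)) * ennreal (u / ?g u) * indicator {0..B} u = indicator {0..B} u"
    proof (cases "u \<in> {0..B}")
      case True
      with u have "u > 0" by auto
      moreover have "sqrt ((?g u)\<^sup>2 - x\<^sup>2) = u" using \<open>u > 0\<close> pos[of u] by simp
      moreover have "?g u > 0" using pos[of u] by simp
      ultimately show ?thesis using True
        by (subst ennreal_mult[symmetric]) (simp_all)
    qed simp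
  qed
  also have "\<dots> = ennreal B" using B by simp
  finally show ?thesis by (simp only: g) (simp only: B_def)
qed

text \<open>The integrand depends on a single Cartesian coordinate x = \<rho> cos \<theta>. At fixed
  \<rho> the angle is traded for \<open>x\<close>, the two half circles giving the factor 2; after
  exchanging the order, the integral over \<rho> yields half the length of the chord at
  \<open>x\<close>.\<close>

lemma nn_integral_disc_polar:
  fixes k :: "real \<Rightarrow> ennreal"
  assumes [measurable]: "k \<in> borel_measurable borel"
  shows "(\<integral>\<^sup>+\<theta>. \<integral>\<^sup>+\<rho>. k (\<rho> * cos \<theta>) * ennreal \<rho> * indicator {0..A} \<rho> * indicator {0..2*pi} \<theta> \<partial>lborel \<partial>lborel)
    = (\<integral>\<^sup>+x. k x * ennreal (2 * sqrt (A\<^sup>2 - x\<^sup>2)) * indicator {-A..A} x \<partial>lborel)"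
proof -
  have "(\<integral>\<^sup>+\<theta>. \<integral>\<^sup>+\<rho>. k (\<rho> * cos \<theta>) * ennreal \<rho> * indicator {0..A} \<rho> * indicator {0..2*pi} \<theta> \<partial>lborel \<partial>lborel)
     = (\<integral>\<^sup>+\<rho>. \<integral>\<^sup>+\<theta>. k (\<rho> * cos \<theta>) * ennreal \<rho> * indicator {0..A} \<rho> * indicator {0..2*pi} \<theta> \<partial>lborel \<partial>lborel)"
    by (rule nn_integral_lborel_swap) simp
  also have "\<dots> = (\<integral>\<^sup>+\<rho>. \<integral>\<^sup>+x. 2 * k x * (ennreal (\<rho> / sqrt (\<rho>\<^sup>2 - x\<^sup>2)) * indicator {\<bar>x\<bar>..A} \<rho>) \<partial>lborel \<partial>lborel)"
  proof (rule nn_integral_cong_AE, use AE_lborel_singleton[of 0] in eventually_elim)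
    fix \<rho> :: real assume "\<rho> \<noteq> 0"
    show "(\<integral>\<^sup>+\<theta>. k (\<rho> * cos \<theta>) * ennreal \<rho> * indicator {0..A} \<rho> * indicator {0..2*pi} \<theta> \<partial>lborel) =
      (\<integral>\<^sup>+x. 2 * k x * (ennreal (\<rho> / sqrt (\<rho>\<^sup>2 - x\<^sup>2)) * indicator {\<bar>x\<bar>..A} \<rho>) \<partial>lborel)"
    proof (cases "\<rho> \<in> {0..A}")
      case True
      with \<open>\<rho> \<noteq> 0\<close> have \<rho>: "\<rho> > 0" by auto
      have "(\<integral>\<^sup>+\<theta>. k (\<rho> * cos \<theta>) * ennreal \<rho> * indicator {0..A} \<rho> * indicator {0..2*pi} \<theta> \<partial>lborel) =
         2 * (\<integral>\<^sup>+\<theta>. k (\<rho> * cos \<theta>) * ennreal \<rho> * indicator {0..pi} \<theta> \<partial>lborel)"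
        using True nn_integral_full_circle[of "\<lambda>c. k (\<rho> * c) * ennreal \<rho>"] by simp
      also have "\<dots> = 2 * (\<integral>\<^sup>+x. k x * ennreal (\<rho> / sqrt (\<rho>\<^sup>2 - x\<^sup>2)) * indicator {-\<rho>..\<rho>} x \<partial>lborel)"
        by (subst nn_integral_semicircle) (use \<rho> in simp_all)
      also have "\<dots> = (\<integral>\<^sup>+x. 2 * (k x * ennreal (\<rho> / sqrt (\<rho>\<^sup>2 - x\<^sup>2)) * indicator {-\<rho>..\<rho>} x) \<partial>lborel)"
        by (rule nn_integral_cmult[symmetric]) simp
      also have "\<dots> = (\<integral>\<^sup>+x. 2 * k x * (ennreal (\<rho> / sqrt (\<rho>\<^sup>2 - x\<^sup>2)) * indicator {\<bar>x\<bar>..A} \<rho>) \<partial>lborel)"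
        using True by (intro nn_integral_cong) (auto split: split_indicator simp: mult.assoc)
      finally show ?thesis .
    next
      case False
      then have "indicator {0..A} \<rho> = (0::ennreal)" "\<And>x. indicator {\<bar>x\<bar>..A} \<rho> = (0::ennreal)"
        by (auto split: split_indicator)
      then show ?thesis by simp
    qed
  qed
  also have "\<dots> = (\<integral>\<^sup>+x. \<integral>\<^sup>+\<rho>. 2 * k x * (ennreal (\<rho> / sqrt (\<rho>\<^sup>2 - x\<^sup>2)) * indicator {\<bar>x\<bar>..A} \<rho>) \<partial>lborel \<partial>lborel)"
    by (rule nn_integral_lborel_swap) (simp add: indicator_def)
  also have "\<dots> = (\<integral>\<^sup>+x. k x * ennreal (2 * sqrt (A\<^sup>2 - x\<^sup>2)) * indicator {-A..A} x \<partial>lborel)"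
  \<comment> \<open>Away from the excluded points either |x| < A and
    \<open>nn_integral_radial\<close> applies, or the range of \<rho> is empty.\<close>
  proof (rule nn_integral_cong_AE,
      use AE_lborel_singleton[of 0] AE_lborel_singleton[of A] AE_lborel_singleton[of "-A"] in eventually_elim)
    fix x :: real assume x: "x \<noteq> 0" "x \<noteq> A" "x \<noteq> - A"
    have "(\<integral>\<^sup>+\<rho>. 2 * k x * (ennreal (\<rho> / sqrt (\<rho>\<^sup>2 - x\<^sup>2)) * indicator {\<bar>x\<bar>..A} \<rho>) \<partial>lborel) =
      2 * k x * (\<integral>\<^sup>+\<rho>. ennreal (\<rho> / sqrt (\<rho>\<^sup>2 - x\<^sup>2)) * indicator {\<bar>x\<bar>..A} \<rho> \<partial>lborel)"
      by (rule nn_integral_cmult) simp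
    also have "\<dots> = k x * ennreal (2 * sqrt (A\<^sup>2 - x\<^sup>2)) * indicator {-A..A} x"
    proof (cases "\<bar>x\<bar> < A")
      case True
      then have "x\<^sup>2 \<le> A\<^sup>2" by (metis abs_le_square_iff abs_of_nonneg less_eq_real_def abs_ge_zero order_trans)
      then show ?thesis using True x
        by (subst nn_integral_radial) (simp_all add: ennreal_mult mult_ac abs_less_iff less_imp_le)
    next
      case False
      with x have "\<not> \<bar>x\<bar> \<le> A" by auto
      then have "{\<bar>x\<bar>..A} = {}" "x \<notin> {-A..A}" by auto
      then show ?thesis by simp
    qed
    finally show "(\<integral>\<^sup>+\<rho>. 2 * k x * (ennreal (\<rho> / sqrt (\<rho>\<^sup>2 - x\<^sup>2)) * indicator {\<bar>x\<bar>..A} \<rho>) \<partial>lborel) =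
       k x * ennreal (2 * sqrt (A\<^sup>2 - x\<^sup>2)) * indicator {-A..A} x" .
  qed
  finally show ?thesis .
qed

subsection \<open>Integrals over caps and balls\<close>

lemma measurable_zc [measurable]: "zc \<in> borel_measurable borel"
  unfolding zc_def[abs_def] by (intro borel_measurable_continuous_onI continuous_intros)

text \<open>For a unit vector \<open>u\<close>, \<open>t\<close> is the signed distance of the
  cutting plane from the centre. Negative values are allowed, so a cap may exceed half of the ball,
  and \<open>t = - r\<close> gives the whole ball.\<close>

definition cap :: "'a::real_inner \<Rightarrow> real \<Rightarrow> 'a \<Rightarrow> real \<Rightarrow> 'a set" where
  "cap C r u t = {p \<in> cball C r. t \<le> (p - C) \<bullet> u}"

lemma closed_cap: "closed (cap C r u t)"
proof -
  have "cap C r u t = cball C r \<inter> {p. t \<le> (p - C) \<bullet> u}" by (auto simp: cap_def)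
  moreover have "closed {p. t \<le> (p - C) \<bullet> u}" by (intro closed_Collect_le continuous_intros)
  ultimately show ?thesis by (simp add: closed_Int)
qed

lemma cap_borel [measurable]: "cap C r u t \<in> sets borel"
  using closed_cap by (rule borel_closed)

text \<open>Polar form of the horizontal part of a unit vector with vertical component \<kappa>. A
  vertical vector has no horizontal direction, and \<open>(1, 0)\<close> is taken instead.\<close>

lemma unit_vector_horizontal_direction:
  fixes a b \<kappa> :: real
  assumes "a\<^sup>2 + b\<^sup>2 + \<kappa>\<^sup>2 = 1"
  obtains e1 e2 where "e1\<^sup>2 + e2\<^sup>2 = 1" "a = sqrt (1 - \<kappa>\<^sup>2) * e1" "b = sqrt (1 - \<kappa>\<^sup>2) * e2"
proof (cases "a\<^sup>2 + b\<^sup>2 = 0")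
  case True
  then show ?thesis using that[of 1 0] assms by (simp add: sum_power2_eq_zero_iff)
next
  case False
  define \<sigma> where "\<sigma> = sqrt (1 - \<kappa>\<^sup>2)"
  have "1 - \<kappa>\<^sup>2 = a\<^sup>2 + b\<^sup>2" using assms by simp
  then have \<sigma>: "\<sigma>\<^sup>2 = a\<^sup>2 + b\<^sup>2" "\<sigma> \<noteq> 0" using False by (simp_all add: \<sigma>_def)
  have "(a / \<sigma>)\<^sup>2 + (b / \<sigma>)\<^sup>2 = 1"
    using False by (simp add: power_divide \<sigma>(1) add_divide_distrib[symmetric])
  then show ?thesis using that[of "a / \<sigma>" "b / \<sigma>"] \<sigma> by (simp add: \<sigma>_def)
qed

text \<open>In an orthonormal frame with first axis \<open>u\<close>, the slice of the cap at
  \<open>w\<close> is a disc of radius sqrt(r^2 - w^2), and on it the height varies only along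
  \<open>v\<close>. This is the situation of \<open>nn_integral_disc_polar\<close>, which turns each
  slice into polar coordinates.\<close>

lemma nn_integral_cap:
  fixes k :: "real \<Rightarrow> ennreal" and C u :: pt
  assumes [measurable]: "k \<in> borel_measurable borel" and u: "norm u = 1" and r: "0 \<le> r" "- r \<le> t"
  shows "(\<integral>\<^sup>+p. k (zc p) * indicator (cap C r u t) p \<partial>lborel) =
    (\<integral>\<^sup>+w. (\<integral>\<^sup>+\<theta>. \<integral>\<^sup>+\<rho>. k (zc C + w * zc u - \<rho> * cos \<theta> * sqrt (1 - (zc u)\<^sup>2)) * ennreal \<rho>
       * indicator {0..sqrt (r\<^sup>2 - w\<^sup>2)} \<rho> * indicator {0..2*pi} \<theta> \<partial>lborel \<partial>lborel) * indicator {t..r} w \<partial>lborel)"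
proof -
  obtain x0 y0 c where C: "C = (x0, y0, c)" by (cases C)
  obtain u1 u2 \<kappa> where u': "u = (u1, u2, \<kappa>)" by (cases u)
  have u1: "u1\<^sup>2 + u2\<^sup>2 + \<kappa>\<^sup>2 = 1"
    using u by (simp add: u' norm_Pair add.assoc)
  then obtain e1 e2 where e: "e1\<^sup>2 + e2\<^sup>2 = 1" "u1 = sqrt (1 - \<kappa>\<^sup>2) * e1" "u2 = sqrt (1 - \<kappa>\<^sup>2) * e2"
    by (rule unit_vector_horizontal_direction)
  define \<sigma> where "\<sigma> = sqrt (1 - \<kappa>\<^sup>2)"
  have "\<kappa>\<^sup>2 \<le> 1" using u1 by (metis add.commute le_add_same_cancel1 sum_power2_ge_zero)
  then have sk: "\<kappa>\<^sup>2 + \<sigma>\<^sup>2 = 1" by (simp add: \<sigma>_def)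
  have u1: "u1 = \<sigma> * e1" and u2: "u2 = \<sigma> * e2" using e by (simp_all add: \<sigma>_def)
  have z: "zc C = c" "zc u = \<kappa>" by (simp_all add: C u' zc_def)
  \<comment> \<open>\<open>T\<close> is the rigid motion taking the origin to \<open>C\<close> and
    the first axis to \<open>u\<close>; the third coordinate \<open>y\<close> is horizontal, so it
    does not enter the height.\<close>
  define T where "T w v y = (x0 + (e1 * (\<sigma> * w + \<kappa> * v) - e2 * y), y0 + (e2 * (\<sigma> * w + \<kappa> * v) + e1 * y),
        c + (\<kappa> * w - \<sigma> * v))" for w v y
  have zT: "zc (T w v y) = c + (w * \<kappa> - v * \<sigma>)" for w v y by (simp add: T_def zc_def)
  have capT: "T w v y \<in> cap C r u t \<longleftrightarrow> w\<^sup>2 + v\<^sup>2 + y\<^sup>2 \<le> r\<^sup>2 \<and> t \<le> w" for w v y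
  proof -
    have "(e1 * (\<sigma> * w + \<kappa> * v) - e2 * y)\<^sup>2 + ((e2 * (\<sigma> * w + \<kappa> * v) + e1 * y)\<^sup>2 + (\<kappa> * w - \<sigma> * v)\<^sup>2)
      = (e1\<^sup>2 + e2\<^sup>2) * ((\<sigma> * w + \<kappa> * v)\<^sup>2 + y\<^sup>2) + (\<kappa> * w - \<sigma> * v)\<^sup>2"
      by algebra
    also have "\<dots> = (\<kappa>\<^sup>2 + \<sigma>\<^sup>2) * (w\<^sup>2 + v\<^sup>2) + y\<^sup>2" unfolding e(1) by algebra
    finally have 1: "(dist (T w v y) C)\<^sup>2 = w\<^sup>2 + v\<^sup>2 + y\<^sup>2"
      by (simp add: T_def C dist_Pair_Pair dist_real_def sk)
    have "dist C (T w v y) \<le> r \<longleftrightarrow> (dist (T w v y) C)\<^sup>2 \<le> r\<^sup>2"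
      using r by (simp add: dist_commute)
    moreover have "(T w v y - C) \<bullet> u = w"
    proof -
      have "(T w v y - C) \<bullet> u = (e1\<^sup>2 + e2\<^sup>2) * \<sigma> * (\<sigma> * w + \<kappa> * v) + (\<kappa> * w - \<sigma> * v) * \<kappa>"
        by (simp add: T_def C u' u1 u2) algebra
      also have "\<dots> = (\<kappa>\<^sup>2 + \<sigma>\<^sup>2) * w" unfolding e(1) by algebra
      finally show ?thesis by (simp add: sk)
    qed
    ultimately show ?thesis by (simp add: cap_def 1)
  qed
  have "(\<integral>\<^sup>+p. k (zc p) * indicator (cap C r u t) p \<partial>lborel) = (\<integral>\<^sup>+w. \<integral>\<^sup>+v. \<integral>\<^sup>+y.
      k (zc (T w v y)) * indicator (cap C r u t) (T w v y) \<partial>lborel \<partial>lborel \<partial>lborel)"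
    unfolding T_def using e(1) sk by (intro nn_integral_lborel3_orthonormal) simp_all
  also have "\<dots> = (\<integral>\<^sup>+w. (\<integral>\<^sup>+\<theta>. \<integral>\<^sup>+\<rho>. k (c + w * \<kappa> - \<rho> * cos \<theta> * \<sigma>) * ennreal \<rho>
       * indicator {0..sqrt (r\<^sup>2 - w\<^sup>2)} \<rho> * indicator {0..2*pi} \<theta> \<partial>lborel \<partial>lborel) * indicator {t..r} w \<partial>lborel)"
  proof (rule nn_integral_cong)
    fix w :: real
    show "(\<integral>\<^sup>+v. \<integral>\<^sup>+y. k (zc (T w v y)) * indicator (cap C r u t) (T w v y) \<partial>lborel \<partial>lborel) =
      (\<integral>\<^sup>+\<theta>. \<integral>\<^sup>+\<rho>. k (c + w * \<kappa> - \<rho> * cos \<theta> * \<sigma>) * ennreal \<rho>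
       * indicator {0..sqrt (r\<^sup>2 - w\<^sup>2)} \<rho> * indicator {0..2*pi} \<theta> \<partial>lborel \<partial>lborel) * indicator {t..r} w"
    proof (cases "w \<in> {t..r}")
      case True
      with r have "\<bar>w\<bar> \<le> \<bar>r\<bar>" by auto
      then have w2: "w\<^sup>2 \<le> r\<^sup>2" by (simp add: abs_le_square_iff)
      define A where "A = sqrt (r\<^sup>2 - w\<^sup>2)"
      have A: "A \<ge> 0" "A\<^sup>2 = r\<^sup>2 - w\<^sup>2" using w2 by (simp_all add: A_def)
      \<comment> \<open>At fixed \<open>w\<close> and \<open>v\<close> the integrand is constant
        along a chord in direction \<open>y\<close>, so the inner integral contributes the chord
        length.\<close>
      have "(\<integral>\<^sup>+v. \<integral>\<^sup>+y. k (zc (T w v y)) * indicator (cap C r u t) (T w v y) \<partial>lborel \<partial>lborel) =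
         (\<integral>\<^sup>+v. k (c + w * \<kappa> - v * \<sigma>) * ennreal (2 * sqrt (A\<^sup>2 - v\<^sup>2)) * indicator {-A..A} v \<partial>lborel)"
      proof (rule nn_integral_cong)
        fix v :: real
        have iff: "T w v y \<in> cap C r u t \<longleftrightarrow> y\<^sup>2 \<le> A\<^sup>2 - v\<^sup>2" for y
          using True A(2) by (auto simp: capT)
        have v: "v \<in> {-A..A} \<longleftrightarrow> v\<^sup>2 \<le> A\<^sup>2"
          using A(1) abs_le_square_iff[of v A] by auto
        show "(\<integral>\<^sup>+y. k (zc (T w v y)) * indicator (cap C r u t) (T w v y) \<partial>lborel) =
           k (c + w * \<kappa> - v * \<sigma>) * ennreal (2 * sqrt (A\<^sup>2 - v\<^sup>2)) * indicator {-A..A} v"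
        proof (cases "v\<^sup>2 \<le> A\<^sup>2")
          case True
          define B where "B = sqrt (A\<^sup>2 - v\<^sup>2)"
          have B: "B \<ge> 0" "B\<^sup>2 = A\<^sup>2 - v\<^sup>2" using True by (simp_all add: B_def)
          have "T w v y \<in> cap C r u t \<longleftrightarrow> y \<in> {-B..B}" for y
            unfolding iff B(2)[symmetric] using B(1) abs_le_square_iff[of y B] by auto
          then have "(\<integral>\<^sup>+y. k (zc (T w v y)) * indicator (cap C r u t) (T w v y) \<partial>lborel) =
            (\<integral>\<^sup>+y. k (c + w * \<kappa> - v * \<sigma>) * indicator {-B..B} y \<partial>lborel)"
            by (intro nn_integral_cong) (simp add: zT indicator_def algebra_simps)
          also have "\<dots> = k (c + w * \<kappa> - v * \<sigma>) * ennreal (2 * B)"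
            using B(1) by (subst nn_integral_cmult_indicator) simp_all
          finally show ?thesis using True v by (simp add: B_def)
        next
          case False
          then have "T w v y \<notin> cap C r u t" for y
            unfolding iff by (smt (verit) zero_le_power2)
          then show ?thesis using False v by simp
        qed
      qed
      \<comment> \<open>The polar formula is read from right to left: the integral of chord lengths
        becomes one over \<rho> and \<theta>.\<close>
      also have "\<dots> = (\<integral>\<^sup>+\<theta>. \<integral>\<^sup>+\<rho>. k (c + w * \<kappa> - \<rho> * cos \<theta> * \<sigma>) * ennreal \<rho>
         * indicator {0..A} \<rho> * indicator {0..2*pi} \<theta> \<partial>lborel \<partial>lborel)"
        by (rule nn_integral_disc_polar[symmetric]) simp
      finally show ?thesis using True by (simp add: A_def)
    next
      case False
      have "T w v y \<notin> cap C r u t" for v y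
      proof
        assume "T w v y \<in> cap C r u t"
        then have *: "w\<^sup>2 + v\<^sup>2 + y\<^sup>2 \<le> r\<^sup>2" "t \<le> w" by (auto simp: capT)
        then have "w\<^sup>2 \<le> r\<^sup>2" by (smt (verit) zero_le_power2)
        then have "w \<le> r" using r(1) by (rule power2_le_imp_le)
        then show False using False * by auto
      qed
      then show ?thesis using False by simp
    qed
  qed
  finally show ?thesis unfolding z \<sigma>_def .
qed

text \<open>The ball is the cap with \<open>t = - r\<close> around the vertical axis. For this axis
  the height is constant on each slice, which contributes the disc area pi (r^2 - w^2).\<close>

lemma nn_integral_cball:
  fixes k :: "real \<Rightarrow> ennreal" and C :: pt
  assumes [measurable]: "k \<in> borel_measurable borel" and r: "0 \<le> r"
  shows "(\<integral>\<^sup>+p. k (zc p) * indicator (cball C r) p \<partial>lborel) =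
    (\<integral>\<^sup>+w. k (w + zc C) * ennreal (pi * (r\<^sup>2 - w\<^sup>2)) * indicator {-r..r} w \<partial>lborel)"
proof -
  define u :: pt where "u = (0, 0, 1)"
  have u: "norm u = 1" "zc u = 1" by (simp_all add: u_def norm_Pair zc_def)
  have "cap C r u (- r) = cball C r"
  proof -
    have "- r \<le> (p - C) \<bullet> u" if "dist C p \<le> r" for p
    proof -
      have "\<bar>(p - C) \<bullet> u\<bar> \<le> norm (p - C) * norm u" by (rule Cauchy_Schwarz_ineq2)
      then show ?thesis using that u by (simp add: dist_norm norm_minus_commute)
    qed
    then show ?thesis by (auto simp: cap_def)
  qed
  then have "(\<integral>\<^sup>+p. k (zc p) * indicator (cball C r) p \<partial>lborel) = 
    (\<integral>\<^sup>+w. (\<integral>\<^sup>+\<theta>. \<integral>\<^sup>+\<rho>. k (zc C + w * zc u - \<rho> * cos \<theta> * sqrt (1 - (zc u)\<^sup>2)) * ennreal \<rho>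
       * indicator {0..sqrt (r\<^sup>2 - w\<^sup>2)} \<rho> * indicator {0..2*pi} \<theta> \<partial>lborel \<partial>lborel) * indicator {-r..r} w \<partial>lborel)"
    using nn_integral_cap[of k u r "-r" C] u r by simp
  also have "\<dots> = (\<integral>\<^sup>+w. k (w + zc C) * ennreal (pi * (r\<^sup>2 - w\<^sup>2)) * indicator {-r..r} w \<partial>lborel)"
  proof (rule nn_integral_cong)
    fix w :: real
    show "(\<integral>\<^sup>+\<theta>. \<integral>\<^sup>+\<rho>. k (zc C + w * zc u - \<rho> * cos \<theta> * sqrt (1 - (zc u)\<^sup>2)) * ennreal \<rho>
       * indicator {0..sqrt (r\<^sup>2 - w\<^sup>2)} \<rho> * indicator {0..2*pi} \<theta> \<partial>lborel \<partial>lborel) * indicator {-r..r} w =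
      k (w + zc C) * ennreal (pi * (r\<^sup>2 - w\<^sup>2)) * indicator {-r..r} w"
    proof (cases "w \<in> {-r..r}")
      case True
      then have "\<bar>w\<bar> \<le> \<bar>r\<bar>" by auto
      then have w2: "w\<^sup>2 \<le> r\<^sup>2" by (simp add: abs_le_square_iff)
      define A where "A = sqrt (r\<^sup>2 - w\<^sup>2)"
      have A: "A \<ge> 0" "A\<^sup>2 = r\<^sup>2 - w\<^sup>2" using w2 by (simp_all add: A_def)
      have A': "(\<integral>\<^sup>+\<rho>. ennreal \<rho> * indicator {0..A} \<rho> \<partial>lborel) = ennreal (A\<^sup>2 / 2 - 0\<^sup>2 / 2)"
        by (rule nn_integral_FTC_Icc) (use A in \<open>auto intro!: derivative_eq_intros\<close>)
      have "(\<integral>\<^sup>+\<theta>. \<integral>\<^sup>+\<rho>. k (zc C + w * zc u - \<rho> * cos \<theta> * sqrt (1 - (zc u)\<^sup>2)) * ennreal \<rho>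
         * indicator {0..A} \<rho> * indicator {0..2*pi} \<theta> \<partial>lborel \<partial>lborel) =
         (\<integral>\<^sup>+\<theta>. \<integral>\<^sup>+\<rho>. k (w + zc C) * indicator {0..2*pi} \<theta> * (ennreal \<rho> * indicator {0..A} \<rho>) \<partial>lborel \<partial>lborel)"
        by (intro nn_integral_cong) (simp add: u mult_ac add.commute)
      also have "\<dots> = (\<integral>\<^sup>+\<theta>. k (w + zc C) * ennreal (A\<^sup>2 / 2) * indicator {0..2*pi} \<theta> \<partial>lborel)"
        by (subst nn_integral_cmult) (simp_all add: A' mult_ac)
      also have "\<dots> = k (w + zc C) * ennreal (A\<^sup>2 / 2) * ennreal (2 * pi)"
        by (subst nn_integral_cmult_indicator) simp_all
      also have "\<dots> = k (w + zc C) * ennreal (pi * (r\<^sup>2 - w\<^sup>2))"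
        by (simp add: mult.assoc ennreal_mult[symmetric] A(2)[symmetric]) (simp add: mult.commute)
      finally show ?thesis using True by (simp add: A_def)
    qed simp
  qed
  finally show ?thesis .
qed

section \<open>From nonnegative integrals to iterated interval integrals\<close>

text \<open>Fubini for the Bochner integral, applied twice. Integrability on the product only makes
  almost every section integrable, hence the second application under an almost-everywhere
  congruence.\<close>

lemma integral_lborel3:
  fixes K :: "real \<times> real \<times> real \<Rightarrow> real"
  assumes K: "integrable lborel K"
  shows "(\<integral>p. K p \<partial>lborel) = (\<integral>x. \<integral>y. \<integral>z. K (x, y, z) \<partial>lborel \<partial>lborel \<partial>lborel)"
proof -
  have [measurable]: "K \<in> borel_measurable borel" using K by auto
  have K': "integrable (lborel \<Otimes>\<^sub>M lborel) K" using K by (simp add: lborel_prod)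
  have 1: "(\<integral>p. K p \<partial>lborel) = (\<integral>x. \<integral>q. K (x, q) \<partial>lborel \<partial>lborel)"
    using lborel_pair.integral_fst'[OF K'] by (simp add: lborel_prod)
  also have "\<dots> = (\<integral>x. \<integral>y. \<integral>z. K (x, y, z) \<partial>lborel \<partial>lborel \<partial>lborel)"
  proof (rule integral_cong_AE)
    show "AE x in lborel. (\<integral>q. K (x, q) \<partial>lborel) = (\<integral>y. \<integral>z. K (x, y, z) \<partial>lborel \<partial>lborel)"
      using lborel_pair.AE_integrable_fst'[OF K']
    proof eventually_elim
      fix x assume "integrable lborel (\<lambda>q. K (x, q))"
      then have "integrable (lborel \<Otimes>\<^sub>M lborel) (\<lambda>q. K (x, q))" by (simp add: lborel_prod)
      from lborel_pair.integral_fst'[OF this]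
      show "(\<integral>q. K (x, q) \<partial>lborel) = (\<integral>y. \<integral>z. K (x, y, z) \<partial>lborel \<partial>lborel)" 
        by (simp add: lborel_prod)
    qed
  qed simp_all
  finally show ?thesis .
qed

text \<open>Serves to pass from the closed ranges of the nonnegative integrals to the open intervals
  over which \<open>LBINT\<close> integrates.\<close>

lemma AE_lborel_Icc_eq_Ioo:
  fixes a b :: real
  shows "AE x in lborel. (indicator {a..b} x :: ennreal) = indicator {a<..<b} x"
  using AE_lborel_singleton[of a] AE_lborel_singleton[of b]
  by eventually_elim (auto split: split_indicator)

lemma interval_integral_eq_integral:
  fixes g :: "real \<Rightarrow> real"
  assumes "a \<le> b"
  shows "(LBINT x=ereal a..ereal b. g x) = (\<integral>x. indicator {a<..<b} x * g x \<partial>lborel)"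
  using assms by (simp add: interval_lebesgue_integral_def set_lebesgue_integral_def)

text \<open>Finiteness of the nonnegative integral makes the cut-off integrand \<open>K\<close>
  integrable on three-space, and Fubini identifies its integral with the iterated one. Nonnegativity
  of \<open>f\<close> is asked only at heights within \<open>r\<close> of the centre, because a
  density on the positive half line is arbitrary elsewhere.\<close>

lemma nn_integral_cap_eq_interval_integral:
  fixes f :: "real \<Rightarrow> real" and C u :: pt
  assumes f[measurable]: "f \<in> borel_measurable borel"
    and nonneg: "\<And>z. \<bar>z - zc C\<bar> \<le> r \<Longrightarrow> 0 \<le> f z"
    and u: "norm u = 1" and r: "0 \<le> r" "- r \<le> t" "t \<le> r"
    and fin: "(\<integral>\<^sup>+p. ennreal (f (zc p)) * indicator (cap C r u t) p \<partial>lborel) < \<infinity>"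
  defines "I \<equiv> (LBINT w=t..r. (LBINT \<theta>=0..2*pi. (LBINT \<rho>=0..sqrt (r\<^sup>2 - w\<^sup>2).
       f (zc C + w * zc u - \<rho> * cos \<theta> * sqrt (1 - (zc u)\<^sup>2)) * \<rho>)))"
  shows "(\<integral>\<^sup>+p. ennreal (f (zc p)) * indicator (cap C r u t) p \<partial>lborel) = ennreal I" and "0 \<le> I"
proof -
  define \<kappa> \<sigma> c where "\<kappa> = zc u" and "\<sigma> = sqrt (1 - \<kappa>\<^sup>2)" and "c = zc C"
  have "(zc u)\<^sup>2 \<le> (norm u)\<^sup>2"
    by (cases u) (simp add: zc_def norm_Pair)
  then have k1: "\<kappa>\<^sup>2 \<le> 1" by (simp add: \<kappa>_def u)
  then have sk: "\<kappa>\<^sup>2 + \<sigma>\<^sup>2 = 1" by (simp add: \<sigma>_def)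
  define A where "A w = sqrt (r\<^sup>2 - w\<^sup>2)" for w
  have [measurable]: "A \<in> borel_measurable borel" unfolding A_def[abs_def] by simp
  define K where "K w \<theta> \<rho> = indicator {t<..<r} w * (indicator {0<..<2*pi} \<theta> *
    (indicator {0<..<A w} \<rho> * (f (c + w * \<kappa> - \<rho> * cos \<theta> * \<sigma>) * \<rho>)))" for w \<theta> \<rho> :: real
  have in_range: "\<bar>(c + w * \<kappa> - \<rho> * cos \<theta> * \<sigma>) - c\<bar> \<le> r" if "w \<in> {t<..<r}" "\<rho> \<in> {0<..<A w}" for w \<theta> \<rho>
  proof -
    from that r have "\<bar>w\<bar> \<le> \<bar>r\<bar>" by auto
    then have w2: "w\<^sup>2 \<le> r\<^sup>2" by (simp add: abs_le_square_iff)
    have "\<rho>\<^sup>2 \<le> (A w)\<^sup>2" using that by (intro power_mono) auto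
    then have r2: "w\<^sup>2 + \<rho>\<^sup>2 \<le> r\<^sup>2" using w2 by (simp add: A_def)
    \<comment> \<open>The height difference is one component of the rotated vector (w, \<rho> cos
      \<theta>); adding the square of the other component gives its full squared length.\<close>
    have "(w * \<kappa> - \<rho> * cos \<theta> * \<sigma>)\<^sup>2 + (w * \<sigma> + \<rho> * cos \<theta> * \<kappa>)\<^sup>2 = (\<kappa>\<^sup>2 + \<sigma>\<^sup>2) * (w\<^sup>2 + (\<rho> * cos \<theta>)\<^sup>2)"
      by algebra
    then have "(w * \<kappa> - \<rho> * cos \<theta> * \<sigma>)\<^sup>2 \<le> w\<^sup>2 + (\<rho> * cos \<theta>)\<^sup>2"
      unfolding sk by (smt (verit) zero_le_power2)
    also have "(\<rho> * cos \<theta>)\<^sup>2 \<le> \<rho>\<^sup>2 * 1"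
      unfolding power_mult_distrib by (intro mult_left_mono) (simp_all add: abs_square_le_1)
    finally have "(w * \<kappa> - \<rho> * cos \<theta> * \<sigma>)\<^sup>2 \<le> r\<^sup>2" using r2 by simp
    then have "\<bar>w * \<kappa> - \<rho> * cos \<theta> * \<sigma>\<bar> \<le> r" using r(1) by (simp add: abs_le_square_iff[symmetric])
    then show ?thesis by simp
  qed
  have K0: "0 \<le> K w \<theta> \<rho>" for w \<theta> \<rho>
    using in_range[of w \<rho> \<theta>] nonneg[of "c + w * \<kappa> - \<rho> * cos \<theta> * \<sigma>"]
    by (auto simp: K_def c_def split: split_indicator)
  have eK: "ennreal (K w \<theta> \<rho>) = ennreal (f (c + w * \<kappa> - \<rho> * cos \<theta> * \<sigma>)) * ennreal \<rho> *
      indicator {0<..<A w} \<rho> * indicator {0<..<2*pi} \<theta> * indicator {t<..<r} w" for w \<theta> \<rho>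
    using in_range[of w \<rho> \<theta>] nonneg[of "c + w * \<kappa> - \<rho> * cos \<theta> * \<sigma>"]
    by (auto simp: K_def c_def ennreal_mult split: split_indicator)
  let ?N = "\<integral>\<^sup>+p. ennreal (f (zc p)) * indicator (cap C r u t) p \<partial>lborel"
  have K_meas[measurable]: "(\<lambda>p. K (fst p) (fst (snd p)) (snd (snd p))) \<in> borel_measurable borel"
  proof -
    have "(\<lambda>(w, \<theta>, \<rho>). K w \<theta> \<rho>) \<in> borel_measurable (borel \<Otimes>\<^sub>M borel \<Otimes>\<^sub>M borel)"
      unfolding K_def indicator_def greaterThanLessThan_iff by measurable
    then show ?thesis by (simp add: borel_prod split_beta')
  qed
  have N: "?N = (\<integral>\<^sup>+p. ennreal (K (fst p) (fst (snd p)) (snd (snd p))) \<partial>lborel)"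
  proof -
    have "?N = (\<integral>\<^sup>+w. (\<integral>\<^sup>+\<theta>. \<integral>\<^sup>+\<rho>. ennreal (f (c + w * \<kappa> - \<rho> * cos \<theta> * \<sigma>)) * ennreal \<rho>
       * indicator {0..A w} \<rho> * indicator {0..2*pi} \<theta> \<partial>lborel \<partial>lborel) * indicator {t..r} w \<partial>lborel)"
      unfolding \<kappa>_def \<sigma>_def c_def A_def by (rule nn_integral_cap) (use u r in simp_all)
    also have "\<dots> = (\<integral>\<^sup>+w. (\<integral>\<^sup>+\<theta>. \<integral>\<^sup>+\<rho>. ennreal (f (c + w * \<kappa> - \<rho> * cos \<theta> * \<sigma>)) * ennreal \<rho>
       * indicator {0<..<A w} \<rho> * indicator {0<..<2*pi} \<theta> \<partial>lborel \<partial>lborel) * indicator {t<..<r} w \<partial>lborel)"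
    proof (rule nn_integral_cong_AE, use AE_lborel_Icc_eq_Ioo[of t r] in eventually_elim)
      fix w assume w: "(indicator {t..r} w :: ennreal) = indicator {t<..<r} w"
      have "(\<integral>\<^sup>+\<theta>. \<integral>\<^sup>+\<rho>. ennreal (f (c + w * \<kappa> - \<rho> * cos \<theta> * \<sigma>)) * ennreal \<rho>
         * indicator {0..A w} \<rho> * indicator {0..2*pi} \<theta> \<partial>lborel \<partial>lborel) = 
        (\<integral>\<^sup>+\<theta>. \<integral>\<^sup>+\<rho>. ennreal (f (c + w * \<kappa> - \<rho> * cos \<theta> * \<sigma>)) * ennreal \<rho>
         * indicator {0<..<A w} \<rho> * indicator {0<..<2*pi} \<theta> \<partial>lborel \<partial>lborel)"
      proof (rule nn_integral_cong_AE, use AE_lborel_Icc_eq_Ioo[of 0 "2*pi"] in eventually_elim)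
        fix \<theta> assume \<theta>: "(indicator {0..2*pi} \<theta> :: ennreal) = indicator {0<..<2*pi} \<theta>"
        show "(\<integral>\<^sup>+\<rho>. ennreal (f (c + w * \<kappa> - \<rho> * cos \<theta> * \<sigma>)) * ennreal \<rho>
           * indicator {0..A w} \<rho> * indicator {0..2*pi} \<theta> \<partial>lborel) = 
          (\<integral>\<^sup>+\<rho>. ennreal (f (c + w * \<kappa> - \<rho> * cos \<theta> * \<sigma>)) * ennreal \<rho>
           * indicator {0<..<A w} \<rho> * indicator {0<..<2*pi} \<theta> \<partial>lborel)"
          unfolding \<theta>
          by (rule nn_integral_cong_AE, use AE_lborel_Icc_eq_Ioo[of 0 "A w"] in eventually_elim) simp
      qed
      then show "(\<integral>\<^sup>+\<theta>. \<integral>\<^sup>+\<rho>. ennreal (f (c + w * \<kappa> - \<rho> * cos \<theta> * \<sigma>)) * ennreal \<rho>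
         * indicator {0..A w} \<rho> * indicator {0..2*pi} \<theta> \<partial>lborel \<partial>lborel) * indicator {t..r} w = 
        (\<integral>\<^sup>+\<theta>. \<integral>\<^sup>+\<rho>. ennreal (f (c + w * \<kappa> - \<rho> * cos \<theta> * \<sigma>)) * ennreal \<rho>
         * indicator {0<..<A w} \<rho> * indicator {0<..<2*pi} \<theta> \<partial>lborel \<partial>lborel) * indicator {t<..<r} w"
        unfolding w by (rule arg_cong)
    qed
    also have "\<dots> = (\<integral>\<^sup>+w. \<integral>\<^sup>+\<theta>. \<integral>\<^sup>+\<rho>. ennreal (K w \<theta> \<rho>) \<partial>lborel \<partial>lborel \<partial>lborel)"
      unfolding eK
    proof (rule nn_integral_cong)
      fix w
      show "(\<integral>\<^sup>+\<theta>. \<integral>\<^sup>+\<rho>. ennreal (f (c + w * \<kappa> - \<rho> * cos \<theta> * \<sigma>)) * ennreal \<rho>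
         * indicator {0<..<A w} \<rho> * indicator {0<..<2*pi} \<theta> \<partial>lborel \<partial>lborel) * indicator {t<..<r} w =
        (\<integral>\<^sup>+\<theta>. \<integral>\<^sup>+\<rho>. ennreal (f (c + w * \<kappa> - \<rho> * cos \<theta> * \<sigma>)) * ennreal \<rho>
         * indicator {0<..<A w} \<rho> * indicator {0<..<2*pi} \<theta> * indicator {t<..<r} w \<partial>lborel \<partial>lborel)"
        by (cases "w \<in> {t<..<r}") simp_all
    qed
    also have "\<dots> = (\<integral>\<^sup>+p. ennreal (K (fst p) (fst (snd p)) (snd (snd p))) \<partial>lborel)"
      by (subst nn_integral_lborel3) simp_all
    finally show ?thesis .
  qed
  have int: "integrable lborel (\<lambda>p. K (fst p) (fst (snd p)) (snd (snd p)))"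
    by (rule integrableI_nonneg) (use fin K0 in \<open>simp_all add: N\<close>)
  have I: "I = (\<integral>p. K (fst p) (fst (snd p)) (snd (snd p)) \<partial>lborel)"
  proof -
    have "I = (\<integral>w. indicator {t<..<r} w * (LBINT \<theta>=0..2*pi. (LBINT \<rho>=0..A w.
       f (c + w * \<kappa> - \<rho> * cos \<theta> * \<sigma>) * \<rho>)) \<partial>lborel)"
      unfolding I_def \<kappa>_def \<sigma>_def c_def A_def using r(3) by (rule interval_integral_eq_integral)
    also have "\<dots> = (\<integral>w. \<integral>\<theta>. \<integral>\<rho>. K w \<theta> \<rho> \<partial>lborel \<partial>lborel \<partial>lborel)"
    proof (rule Bochner_Integration.integral_cong[OF refl])
      fix w
      show "indicator {t<..<r} w * (LBINT \<theta>=0..2*pi. (LBINT \<rho>=0..A w.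
         f (c + w * \<kappa> - \<rho> * cos \<theta> * \<sigma>) * \<rho>)) = (\<integral>\<theta>. \<integral>\<rho>. K w \<theta> \<rho> \<partial>lborel \<partial>lborel)"
      proof (cases "w \<in> {t<..<r}")
        case True
        with r have "\<bar>w\<bar> \<le> \<bar>r\<bar>" by auto
        then have w2: "w\<^sup>2 \<le> r\<^sup>2" by (simp add: abs_le_square_iff)
        then have "0 \<le> A w" by (simp add: A_def)
        then show ?thesis
          using interval_integral_eq_integral[of 0 "2 * pi"] interval_integral_eq_integral[of 0 "A w"]
          by (simp add: K_def zero_ereal_def)
      qed (simp add: K_def)
    qed
    also have "\<dots> = (\<integral>p. K (fst p) (fst (snd p)) (snd (snd p)) \<partial>lborel)"
      using integral_lborel3[OF int] by simp
    finally show ?thesis .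
  qed
  show "?N = ennreal I"
    unfolding N I by (rule nn_integral_eq_integral[OF int]) (simp add: K0)
  show "0 \<le> I" unfolding I by (rule integral_nonneg_AE) (simp add: K0)
qed

text \<open>The same passage for a full ball, where only the integral over \<open>w\<close> remains.
  That integral inherits finiteness because the factor pi is nonzero.\<close>

lemma nn_integral_cball_eq_interval_integral:
  fixes f :: "real \<Rightarrow> real" and C :: pt
  assumes f[measurable]: "f \<in> borel_measurable borel"
    and nonneg: "\<And>z. \<bar>z - zc C\<bar> \<le> r \<Longrightarrow> 0 \<le> f z" and r: "0 \<le> r"
    and fin: "(\<integral>\<^sup>+p. ennreal (f (zc p)) * indicator (cball C r) p \<partial>lborel) < \<infinity>"
  defines "I \<equiv> pi * (LBINT w=-r..r. f (w + zc C) * (r\<^sup>2 - w\<^sup>2))"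
  shows "(\<integral>\<^sup>+p. ennreal (f (zc p)) * indicator (cball C r) p \<partial>lborel) = ennreal I" and "0 \<le> I"
proof -
  let ?K = "\<lambda>w. indicator {-r<..<r} w * (f (w + zc C) * (r\<^sup>2 - w\<^sup>2))"
  let ?N = "\<integral>\<^sup>+p. ennreal (f (zc p)) * indicator (cball C r) p \<partial>lborel"
  have *: "0 \<le> f (w + zc C) \<and> 0 \<le> r\<^sup>2 - w\<^sup>2" if "w \<in> {-r<..<r}" for w
  proof -
    from that have "\<bar>w\<bar> \<le> \<bar>r\<bar>" by auto
    then have "w\<^sup>2 \<le> r\<^sup>2" by (simp add: abs_le_square_iff)
    then show ?thesis using that by (auto intro!: nonneg)
  qed
  then have K0: "0 \<le> ?K w" for w by (auto split: split_indicator)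
  have "?N = (\<integral>\<^sup>+w. ennreal (f (w + zc C)) * ennreal (pi * (r\<^sup>2 - w\<^sup>2)) * indicator {-r..r} w \<partial>lborel)"
    by (rule nn_integral_cball) (use r in simp_all)
  also have "\<dots> = (\<integral>\<^sup>+w. ennreal pi * ennreal (?K w) \<partial>lborel)"
  proof (rule nn_integral_cong_AE, use AE_lborel_Icc_eq_Ioo[of "-r" r] in eventually_elim)
    fix w assume w: "(indicator {-r..r} w :: ennreal) = indicator {-r<..<r} w"
    show "ennreal (f (w + zc C)) * ennreal (pi * (r\<^sup>2 - w\<^sup>2)) * indicator {-r..r} w = ennreal pi * ennreal (?K w)"
      unfolding w using *[of w] by (auto split: split_indicator simp: ennreal_mult mult_ac)
  qed
  also have "\<dots> = ennreal pi * (\<integral>\<^sup>+w. ennreal (?K w) \<partial>lborel)"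
    by (rule nn_integral_cmult) simp
  finally have N: "?N = ennreal pi * (\<integral>\<^sup>+w. ennreal (?K w) \<partial>lborel)" .
  have "(\<integral>\<^sup>+w. ennreal (?K w) \<partial>lborel) < \<infinity>"
    using fin unfolding N by (auto simp: ennreal_mult_less_top)
  then have int: "integrable lborel ?K"
    by (intro integrableI_nonneg) (use K0 in simp_all)
  have I: "I = pi * (\<integral>w. ?K w \<partial>lborel)"
    unfolding I_def using interval_integral_eq_integral[of "-r" r] r by simp
  show "?N = ennreal I"
    unfolding N I using K0 by (subst nn_integral_eq_integral[OF int]) (simp_all add: ennreal_mult integral_nonneg)
  show "0 \<le> I" unfolding I using K0 by (intro mult_nonneg_nonneg integral_nonneg_AE) simp_all
qed

section \<open>Two balls and their radical plane\<close>

text \<open>\<open>t\<close> locates the radical plane along \<open>u\<close>, where |p - C|^2 - r^2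
  and |p - C'|^2 - r'^2 agree. Beyond it, towards \<open>C'\<close>, the second quantity is the
  smaller one, so membership in the ball around \<open>C\<close> implies membership in the other; on
  the near side the roles are exchanged.\<close>

lemma cball_Int_cball_eq_caps:
  fixes C C' :: "'a::euclidean_space"
  assumes ne: "C \<noteq> C'" and r: "0 \<le> r" "0 \<le> r'"
  defines "d \<equiv> dist C C'"
  defines "u \<equiv> (C' - C) /\<^sub>R d" and "t \<equiv> (d\<^sup>2 + r\<^sup>2 - r'\<^sup>2) / (2 * d)"
  shows "p \<in> cap C r u t \<longleftrightarrow> p \<in> cball C r \<inter> cball C' r' \<and> t \<le> (p - C) \<bullet> u"
    and "p \<in> cap C' r' (- u) (d - t) \<longleftrightarrow> p \<in> cball C r \<inter> cball C' r' \<and> (p - C) \<bullet> u \<le> t"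
proof -
  have d: "d > 0" using ne by (simp add: d_def)
  have C': "C' = C + d *\<^sub>R u" using d by (simp add: u_def)
  have nu: "norm u = 1" using ne by (simp add: u_def d_def dist_norm norm_minus_commute)
  then have uu: "u \<bullet> u = 1" by (simp add: norm_eq_1)
  have w': "(p - C') \<bullet> (- u) = d - (p - C) \<bullet> u"
    by (simp add: C' inner_diff_left inner_add_left uu algebra_simps)
  have "(norm (p - C'))\<^sup>2 = (norm (p - C))\<^sup>2 - 2 * d * ((p - C) \<bullet> u) + d\<^sup>2"
    unfolding power2_norm_eq_inner C'
    by (simp add: inner_diff_left inner_diff_right inner_add_left inner_add_right uu inner_commute
        algebra_simps power2_eq_square)
  moreover have "r'\<^sup>2 = r\<^sup>2 - 2 * d * t + d\<^sup>2"
    using d by (simp add: t_def)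
  \<comment> \<open>The quadratic terms cancel: the two powers of \<open>p\<close> differ by an
    affine function that vanishes on the radical plane.\<close>
  ultimately have eq: "(norm (p - C'))\<^sup>2 - r'\<^sup>2 = (norm (p - C))\<^sup>2 - r\<^sup>2 + 2 * d * (t - (p - C) \<bullet> u)"
    by (simp add: algebra_simps)
  have B: "p \<in> cball C r \<longleftrightarrow> (norm (p - C))\<^sup>2 \<le> r\<^sup>2" "p \<in> cball C' r' \<longleftrightarrow> (norm (p - C'))\<^sup>2 \<le> r'\<^sup>2"
    using r by (simp_all add: dist_norm norm_minus_commute abs_le_square_iff[symmetric])
  have "p \<in> cball C' r'" if "p \<in> cball C r" "t \<le> (p - C) \<bullet> u"
  proof -
    have "d * (t - (p - C) \<bullet> u) \<le> 0" using that d by (simp add: mult_nonneg_nonpos)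
    then show ?thesis using that eq unfolding B by linarith
  qed
  then show "p \<in> cap C r u t \<longleftrightarrow> p \<in> cball C r \<inter> cball C' r' \<and> t \<le> (p - C) \<bullet> u"
    unfolding cap_def by blast
  have "p \<in> cball C r" if "p \<in> cball C' r'" "(p - C) \<bullet> u \<le> t"
  proof -
    have "0 \<le> d * (t - (p - C) \<bullet> u)" using that d by simp
    then show ?thesis using that eq unfolding B by linarith
  qed
  then show "p \<in> cap C' r' (- u) (d - t) \<longleftrightarrow> p \<in> cball C r \<inter> cball C' r' \<and> (p - C) \<bullet> u \<le> t"
    unfolding cap_def mem_Collect_eq w' by auto
qed

lemma AE_lborel_not_hyperplane:
  fixes u :: "'a::euclidean_space"
  assumes "u \<noteq> 0"
  shows "AE p in lborel. (p - C) \<bullet> u \<noteq> t"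
proof -
  have "{p. \<not> (p - C) \<bullet> u \<noteq> t} = {p. u \<bullet> p = t + u \<bullet> C}"
    by (auto simp: inner_diff_left inner_commute[of u])
  moreover have "negligible {p. u \<bullet> p = t + u \<bullet> C}"
    using assms by (intro negligible_hyperplane) simp
  moreover have "{p. u \<bullet> p = t + u \<bullet> C} \<in> sets borel"
    by (intro borel_closed closed_hyperplane)
  ultimately have "{p. \<not> (p - C) \<bullet> u \<noteq> t} \<in> null_sets lborel"
    by (simp add: negligible_iff_null_sets null_sets_def)
  then show ?thesis by (rule AE_I') simp
qed

text \<open>Inclusion-exclusion, the intersection being split into the two caps. It is stated as an
  equality of sums since cancellation in \<open>ennreal\<close> must wait until finiteness is
  known.\<close>

lemma nn_integral_cball_Un:
  fixes g :: "'a::euclidean_space \<Rightarrow> ennreal"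
  assumes g[measurable]: "g \<in> borel_measurable borel" and ne: "C \<noteq> C'" and r: "0 \<le> r" "0 \<le> r'"
  defines "d \<equiv> dist C C'"
  defines "u \<equiv> (C' - C) /\<^sub>R d" and "t \<equiv> (d\<^sup>2 + r\<^sup>2 - r'\<^sup>2) / (2 * d)"
  shows "(\<integral>\<^sup>+p. g p * indicator (cball C r \<union> cball C' r') p \<partial>lborel)
      + ((\<integral>\<^sup>+p. g p * indicator (cap C r u t) p \<partial>lborel)
      + (\<integral>\<^sup>+p. g p * indicator (cap C' r' (- u) (d - t)) p \<partial>lborel)) =
    (\<integral>\<^sup>+p. g p * indicator (cball C r) p \<partial>lborel) + (\<integral>\<^sup>+p. g p * indicator (cball C' r') p \<partial>lborel)"
proof -
  note caps = cball_Int_cball_eq_caps[OF ne r, folded d_def, folded u_def t_def]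
  have u0: "u \<noteq> 0" using ne by (simp add: u_def d_def)
  have [measurable]: "cball C r \<in> sets borel" "cball C' r' \<in> sets borel" by (simp_all add: borel_closed)
  have "(\<integral>\<^sup>+p. g p * indicator (cball C r \<union> cball C' r') p \<partial>lborel)
      + ((\<integral>\<^sup>+p. g p * indicator (cap C r u t) p \<partial>lborel)
      + (\<integral>\<^sup>+p. g p * indicator (cap C' r' (- u) (d - t)) p \<partial>lborel)) =
     (\<integral>\<^sup>+p. g p * indicator (cball C r \<union> cball C' r') p
       + (g p * indicator (cap C r u t) p + g p * indicator (cap C' r' (- u) (d - t)) p) \<partial>lborel)"
    by (simp add: nn_integral_add)
  also have "\<dots> = (\<integral>\<^sup>+p. g p * indicator (cball C r) p + g p * indicator (cball C' r') p \<partial>lborel)"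
  \<comment> \<open>Both caps contain the points of the intersection on the radical plane, which
    would be counted twice; the plane is a null set.\<close>
  proof (rule nn_integral_cong_AE, use AE_lborel_not_hyperplane[OF u0, of C t] in eventually_elim)
    fix p assume "(p - C) \<bullet> u \<noteq> t"
    then show "g p * indicator (cball C r \<union> cball C' r') p
       + (g p * indicator (cap C r u t) p + g p * indicator (cap C' r' (- u) (d - t)) p) =
      g p * indicator (cball C r) p + g p * indicator (cball C' r') p"
      by (cases "(p - C) \<bullet> u \<le> t"; cases "p \<in> cball C r"; cases "p \<in> cball C' r'")
         (simp_all add: indicator_def caps del: mem_cball)
  qed
  also have "\<dots> = (\<integral>\<^sup>+p. g p * indicator (cball C r) p \<partial>lborel) + (\<integral>\<^sup>+p. g p * indicator (cball C' r') p \<partial>lborel)"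
    by (rule nn_integral_add) simp_all
  finally show ?thesis .
qed

subsection \<open>Void probabilities\<close>

text \<open>The Poisson law at \<open>k = 0\<close> gives the probability of a zero count. Replacing
  a zero count by emptiness needs the void event to be measurable, as \<open>M\<close> need not be
  complete.\<close>

lemma poisson_process_void_probability:
  assumes PP: "poisson_process M \<Phi> \<mu>" and sets: "sets \<mu> = sets borel"
    and S: "S \<in> sets borel" and fin: "emeasure \<mu> S < \<infinity>"
  shows "measure M {\<omega> \<in> space M. \<Phi> \<omega> \<inter> S = {}} = exp (- measure \<mu> S)"
proof -
  interpret prob_space M using PP by (simp add: poisson_process_def)
  have card_meas: "{\<omega> \<in> space M. card (\<Phi> \<omega> \<inter> A) = 0} \<in> events"
    if "A \<in> sets borel" "emeasure \<mu> A < \<infinity>" for A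
  proof -
    have "(\<lambda>\<omega>. card (\<Phi> \<omega> \<inter> A)) \<in> measurable M (count_space UNIV)"
      using PP that by (simp add: poisson_process_def sets)
    from measurable_sets[OF this, of "{0}"] show ?thesis
      by (simp add: vimage_def Int_def conj_commute)
  qed
  define T where "T n = S \<inter> cball 0 (real n)" for n
  have T: "T n \<in> sets borel" "emeasure \<mu> (T n) < \<infinity>" for n
  proof -
    show "T n \<in> sets borel" using S by (simp add: T_def borel_closed)
    have "emeasure \<mu> (T n) \<le> emeasure \<mu> S" using S by (intro emeasure_mono) (auto simp: T_def sets)
    then show "emeasure \<mu> (T n) < \<infinity>" using fin by (rule le_less_trans)
  qed
  \<comment> \<open>\<open>card\<close> of an infinite set is 0, so an empty count on the possibly unbounded \<open>S\<close> only gives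
    emptiness almost surely; local finiteness makes the counts on the bounded pieces reliable.\<close>
  have void_eq: "{\<omega> \<in> space M. \<Phi> \<omega> \<inter> S = {}} = (\<Inter>n. {\<omega> \<in> space M. card (\<Phi> \<omega> \<inter> T n) = 0})"
  proof -
    have "\<Phi> \<omega> \<inter> S = {} \<longleftrightarrow> (\<forall>n. card (\<Phi> \<omega> \<inter> T n) = 0)" if "\<omega> \<in> space M" for \<omega>
    proof -
      have "finite (\<Phi> \<omega> \<inter> T n)" for n
      proof -
        have "bounded (T n)" unfolding T_def by (rule bounded_subset[OF bounded_cball]) auto
        then show ?thesis using PP that by (simp add: poisson_process_def)
      qed
      then have "(\<forall>n. card (\<Phi> \<omega> \<inter> T n) = 0) \<longleftrightarrow> (\<forall>n. \<Phi> \<omega> \<inter> T n = {})" by simp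
      also have "\<dots> \<longleftrightarrow> \<Phi> \<omega> \<inter> S = {}"
      proof -
        have "\<exists>n. p \<in> cball 0 (real n)" for p :: pt
          using real_arch_simple[of "norm p"] by simp
        then show ?thesis unfolding T_def by blast
      qed
      finally show ?thesis by simp
    qed
    then show ?thesis by auto
  qed
  have void_meas: "{\<omega> \<in> space M. \<Phi> \<omega> \<inter> S = {}} \<in> events"
    unfolding void_eq by (intro sets.countable_INT) (auto intro: card_meas T)
  have "AE \<omega> in M. finite (\<Phi> \<omega> \<inter> S)"
    using PP S fin by (simp add: poisson_process_def sets)
  then have "AE \<omega> in M. \<Phi> \<omega> \<inter> S = {} \<longleftrightarrow> card (\<Phi> \<omega> \<inter> S) = 0"
    by eventually_elim simp
  then have "measure M {\<omega> \<in> space M. \<Phi> \<omega> \<inter> S = {}} = measure M {\<omega> \<in> space M. card (\<Phi> \<omega> \<inter> S) = 0}"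
    by (rule prob_eq_AE[OF _ void_meas card_meas[OF S fin]])
  also have "\<dots> = exp (- measure \<mu> S)"
  proof -
    have "measure M {\<omega> \<in> space M. card (\<Phi> \<omega> \<inter> S) = k} = measure \<mu> S ^ k / fact k * exp (- measure \<mu> S)" for k
      using PP S fin by (simp add: poisson_process_def sets)
    from this[of 0] show ?thesis by simp
  qed
  finally show ?thesis .
qed

subsection \<open>Hyperbolic balls\<close>

text \<open>\<open>b\<close> itself is a candidate, and any other candidate no farther from
  \<open>a\<close> than a minimizer would be a second minimizer. The uniqueness required by
  \<open>nn_rel\<close> therefore becomes the strict inequality.\<close>

lemma nn_rel_insert_iff:
  assumes "a \<noteq> b"
  shows "nn_rel (\<phi> \<union> {a, b}) a b \<longleftrightarrow> (\<forall>c\<in>\<phi>. c \<noteq> a \<longrightarrow> c \<noteq> b \<longrightarrow> dH3 a b < dH3 a c)"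
proof
  assume nn: "nn_rel (\<phi> \<union> {a, b}) a b"
  show "\<forall>c\<in>\<phi>. c \<noteq> a \<longrightarrow> c \<noteq> b \<longrightarrow> dH3 a b < dH3 a c"
  proof (intro ballI impI)
    fix c assume c: "c \<in> \<phi>" "c \<noteq> a" "c \<noteq> b"
    show "dH3 a b < dH3 a c"
    proof (rule ccontr)
      assume "\<not> dH3 a b < dH3 a c"
      then have "is_arg_min (dH3 a) (\<lambda>c. c \<in> \<phi> \<union> {a, b} - {a}) c"
        using nn c unfolding nn_rel_def is_arg_min_def by (meson DiffI UnCI less_le_trans not_less singletonD)
      then show False using nn c unfolding nn_rel_def by blast
    qed
  qed
next
  assume *: "\<forall>c\<in>\<phi>. c \<noteq> a \<longrightarrow> c \<noteq> b \<longrightarrow> dH3 a b < dH3 a c"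
  then have "is_arg_min (dH3 a) (\<lambda>c. c \<in> \<phi> \<union> {a, b} - {a}) c \<longleftrightarrow> c = b" for c
    using assms unfolding is_arg_min_def by (metis DiffE DiffI UnE UnI2 insertE insertI1 insertI2 order_less_asym singletonD)
  then show "nn_rel (\<phi> \<union> {a, b}) a b" unfolding nn_rel_def by blast
qed

lemma dE_commute: "dE a b = dE b a"
  by (simp add: dE_def power2_commute)

lemma dH3_commute: "dH3 a b = dH3 b a"
  by (simp add: dH3_def dE_commute[of a b] mult.commute mult.left_commute add.commute)

text \<open>\<open>a\<close> and \<open>b\<close> are removed because a configuration may already
  contain them. Points outside \<open>H3\<close> are kept, as a configuration is an arbitrary subset
  of three-space; the intensity gives them no mass.\<close>

definition exclusion_region :: "pt \<Rightarrow> pt \<Rightarrow> pt set" where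
  "exclusion_region a b = {c. c \<noteq> a \<and> c \<noteq> b \<and> (dH3 a c \<le> dH3 a b \<or> dH3 b c \<le> dH3 a b)}"

lemma mnnr_iff_exclusion_region_empty:
  assumes "a \<noteq> b"
  shows "mnnr D (\<phi> \<union> {a, b}) a b \<longleftrightarrow> (zc a, zc b) \<in> D \<and> \<phi> \<inter> exclusion_region a b = {}"
proof -
  have "nn_rel (\<phi> \<union> {a, b}) b a \<longleftrightarrow> (\<forall>c\<in>\<phi>. c \<noteq> b \<longrightarrow> c \<noteq> a \<longrightarrow> dH3 a b < dH3 b c)"
    using nn_rel_insert_iff[of b a \<phi>] assms by (simp add: insert_commute dH3_commute[of b a])
  then show ?thesis
    unfolding mnnr_def nn_rel_insert_iff[OF assms] exclusion_region_def
    by (auto simp: not_le)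
qed

lemma measurable_dH3 [measurable]: "dH3 a \<in> borel_measurable borel"
proof -
  have [measurable]: "(fst :: pt \<Rightarrow> real) \<in> borel_measurable borel"
      "(\<lambda>p :: pt. fst (snd p)) \<in> borel_measurable borel"
    by (intro borel_measurable_continuous_onI continuous_intros)+
  show ?thesis
    unfolding dH3_def[abs_def] dE_def arcosh_def by simp
qed

lemma exclusion_region_borel: "exclusion_region a b \<in> sets borel"
  unfolding exclusion_region_def by measurable

text \<open>The argument of \<open>arcosh\<close> equals 1 plus the squared Euclidean distance of
  the points divided by twice the product of their heights. It is thus at least 1, with equality
  only for coinciding points.\<close>

lemma cosh_dH3:
  assumes a: "a \<in> H3" and b: "b \<in> H3"
  shows "cosh (dH3 a b) = ((dE a b)\<^sup>2 + (zc a)\<^sup>2 + (zc b)\<^sup>2) / (2 * zc a * zc b)"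
    and "dH3 a b \<ge> 0" and "a \<noteq> b \<Longrightarrow> dH3 a b > 0"
proof -
  have z: "zc a > 0" "zc b > 0" using a b by (simp_all add: H3_def)
  define X where "X = (dE a b)\<^sup>2 / (2 * zc a * zc b) + (zc a / zc b + zc b / zc a) / 2"
  have X: "X = ((dE a b)\<^sup>2 + (zc a)\<^sup>2 + (zc b)\<^sup>2) / (2 * zc a * zc b)"
    using z by (simp add: X_def field_simps power2_eq_square)
  have X1: "X = 1 + ((dE a b)\<^sup>2 + (zc a - zc b)\<^sup>2) / (2 * zc a * zc b)"
    unfolding X using z by (simp add: field_simps power2_eq_square)
  have ge: "X \<ge> 1" unfolding X1 using z by simp
  have d: "dH3 a b = arcosh X" by (simp add: dH3_def X_def)
  show "cosh (dH3 a b) = ((dE a b)\<^sup>2 + (zc a)\<^sup>2 + (zc b)\<^sup>2) / (2 * zc a * zc b)"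
    unfolding d X[symmetric] using ge by simp
  show "dH3 a b \<ge> 0" unfolding d using ge by simp
  assume ne: "a \<noteq> b"
  have "(dE a b)\<^sup>2 + (zc a - zc b)\<^sup>2 \<noteq> 0"
  proof
    assume "(dE a b)\<^sup>2 + (zc a - zc b)\<^sup>2 = 0"
    then have "dE a b = 0" "zc a = zc b" by (simp_all add: sum_power2_eq_zero_iff)
    then have "a = b" by (cases a; cases b) (simp add: dE_def zc_def sum_power2_eq_zero_iff)
    then show False using ne by simp
  qed
  then have "X \<noteq> 1" unfolding X1 using z by simp
  then show "dH3 a b > 0" unfolding d using ge by simp
qed

text \<open>Euclidean centre of the hyperbolic ball of radius \<open>R\<close> around
  \<open>a\<close>; it lies above \<open>a\<close> for nonzero \<open>R\<close> when
  \<open>a\<close> is in \<open>H3\<close>.\<close>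

definition eucl_center :: "pt \<Rightarrow> real \<Rightarrow> pt" where
  "eucl_center a R = (fst a, fst (snd a), zc a * cosh R)"

lemma zc_eucl_center [simp]: "zc (eucl_center a R) = zc a * cosh R"
  by (simp add: eucl_center_def zc_def)

text \<open>After taking \<open>cosh\<close>, the condition is quadratic in the height of
  \<open>p\<close>. Completing the square at \<open>zc a * cosh R\<close> leaves the squared radius
  (zc a)^2 (cosh^2 R - 1).\<close>

lemma dH3_le_iff_cball:
  assumes a: "a \<in> H3" and p: "p \<in> H3" and R: "0 \<le> R"
  shows "dH3 a p \<le> R \<longleftrightarrow> p \<in> cball (eucl_center a R) (zc a * sinh R)"
proof -
  have z: "zc a > 0" "zc p > 0" using a p by (simp_all add: H3_def)
  have "dH3 a p \<le> R \<longleftrightarrow> cosh (dH3 a p) \<le> cosh R"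
    using cosh_dH3(2)[OF a p] R by (simp add: cosh_real_nonneg_le_iff)
  also have "\<dots> \<longleftrightarrow> (dE a p)\<^sup>2 + (zc a)\<^sup>2 + (zc p)\<^sup>2 \<le> cosh R * (2 * zc a * zc p)"
    unfolding cosh_dH3(1)[OF a p] using z by (simp add: pos_divide_le_eq)
  also have "\<dots> \<longleftrightarrow> (dE a p)\<^sup>2 + (zc a * cosh R - zc p)\<^sup>2 \<le> (zc a * sinh R)\<^sup>2"
  proof -
    have "(zc a * sinh R)\<^sup>2 = (zc a)\<^sup>2 * ((cosh R)\<^sup>2 - 1)"
      by (simp add: power_mult_distrib sinh_square_eq)
    then show ?thesis by (auto simp: power2_eq_square algebra_simps)
  qed
  also have "\<dots> \<longleftrightarrow> (dist (eucl_center a R) p)\<^sup>2 \<le> (zc a * sinh R)\<^sup>2"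
  proof -
    have "(dist (eucl_center a R) p)\<^sup>2 = (dE a p)\<^sup>2 + (zc a * cosh R - zc p)\<^sup>2"
      by (cases p) (simp add: eucl_center_def dist_Pair_Pair dist_real_def dE_def zc_def)
    then show ?thesis by simp
  qed
  also have "\<dots> \<longleftrightarrow> dist (eucl_center a R) p \<le> zc a * sinh R"
    using z R by (simp add: abs_le_square_iff[symmetric])
  finally show ?thesis by simp
qed

lemma abs_zc_diff_le_dist: "\<bar>zc p - zc q\<bar> \<le> dist p q"
proof -
  have "dist (snd (snd p)) (snd (snd q)) \<le> dist p q"
    using dist_snd_le[of p q] dist_snd_le[of "snd p" "snd q"] by linarith
  then show ?thesis by (simp add: zc_def dist_real_def)
qed

text \<open>Since \<open>sinh R < cosh R\<close>, the radius is smaller than the height of the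
  centre. The version for heights alone supplies the sign of \<open>f\<close> in the integral
  formulas.\<close>

lemma cball_eucl_center_subset_H3:
  assumes a: "a \<in> H3"
  shows "\<bar>z - zc (eucl_center a R)\<bar> \<le> zc a * sinh R \<Longrightarrow> z > 0"
    and "cball (eucl_center a R) (zc a * sinh R) \<subseteq> H3"
proof -
  have z: "zc a > 0" using a by (simp add: H3_def)
  have "sinh R < cosh R" by (simp add: sinh_def cosh_def field_simps)
  then have lt: "zc a * sinh R < zc a * cosh R" using z by simp
  show pos: "z > 0" if "\<bar>z - zc (eucl_center a R)\<bar> \<le> zc a * sinh R" for z
    using that lt by simp
  show "cball (eucl_center a R) (zc a * sinh R) \<subseteq> H3"
  proof
    fix p assume "p \<in> cball (eucl_center a R) (zc a * sinh R)"
    then have "\<bar>zc p - zc (eucl_center a R)\<bar> \<le> zc a * sinh R"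
      using abs_zc_diff_le_dist[of p "eucl_center a R"] by (simp add: dist_commute)
    then show "p \<in> H3" using pos by (simp add: H3_def)
  qed
qed

section \<open>Intensity of the exclusion region\<close>

text \<open>The density vanishes outside \<open>H3\<close>, so \<open>S\<close> may be replaced by
  any Borel subset of \<open>H3\<close> that agrees with it almost everywhere inside
  \<open>H3\<close>.\<close>

lemma emeasure_PPP_intensity:
  assumes [measurable]: "f \<in> borel_measurable borel" and lam: "lam > 0" and S: "S \<in> sets borel"
    and B[measurable]: "B \<in> sets borel" and "B \<subseteq> H3" and AE: "AE p in lborel. p \<in> H3 \<longrightarrow> (p \<in> S \<longleftrightarrow> p \<in> B)"
  shows "emeasure (PPP_intensity lam f) S = ennreal lam * (\<integral>\<^sup>+p. ennreal (f (zc p)) * indicator B p \<partial>lborel)"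
proof -
  have "emeasure (PPP_intensity lam f) S =
      (\<integral>\<^sup>+p. (if zc p > 0 then ennreal (lam * f (zc p)) else 0) * indicator S p \<partial>lborel)"
    unfolding PPP_intensity_def using S by (intro emeasure_density) simp_all
  also have "\<dots> = (\<integral>\<^sup>+p. ennreal lam * (ennreal (f (zc p)) * indicator B p) \<partial>lborel)"
  proof (rule nn_integral_cong_AE, use AE in eventually_elim)
    fix p assume "p \<in> H3 \<longrightarrow> (p \<in> S \<longleftrightarrow> p \<in> B)"
    then show "(if zc p > 0 then ennreal (lam * f (zc p)) else 0) * indicator S p =
        ennreal lam * (ennreal (f (zc p)) * indicator B p)"
      using \<open>B \<subseteq> H3\<close> lam by (auto simp: H3_def ennreal_mult' split: split_indicator)
  qed
  also have "\<dots> = ennreal lam * (\<integral>\<^sup>+p. ennreal (f (zc p)) * indicator B p \<partial>lborel)"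
    by (rule nn_integral_cmult) simp
  finally show ?thesis .
qed

text \<open>Horizontal slices of the ball have area at most pi r^2, so the integral is bounded by pi
  r^2 times the mass of \<open>f\<close> on the positive half line.\<close>

lemma nn_integral_cball_finite:
  fixes f :: "real \<Rightarrow> real"
  assumes [measurable]: "f \<in> borel_measurable borel"
    and dens: "(\<integral>\<^sup>+z\<in>{0<..}. ennreal (f z) \<partial>lborel) < \<infinity>"
    and r: "0 \<le> r" and pos: "\<And>z. \<bar>z - zc C\<bar> \<le> r \<Longrightarrow> 0 < z"
  shows "(\<integral>\<^sup>+p. ennreal (f (zc p)) * indicator (cball C r) p \<partial>lborel) < \<infinity>"
proof -
  have "(\<integral>\<^sup>+p. ennreal (f (zc p)) * indicator (cball C r) p \<partial>lborel) =
      (\<integral>\<^sup>+w. ennreal (f (w + zc C)) * ennreal (pi * (r\<^sup>2 - w\<^sup>2)) * indicator {-r..r} w \<partial>lborel)"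
    by (rule nn_integral_cball) (use r in simp_all)
  also have "\<dots> \<le> (\<integral>\<^sup>+w. ennreal (pi * r\<^sup>2) * (ennreal (f (w + zc C)) * indicator {0<..} (w + zc C)) \<partial>lborel)"
  proof (rule nn_integral_mono)
    fix w
    show "ennreal (f (w + zc C)) * ennreal (pi * (r\<^sup>2 - w\<^sup>2)) * indicator {-r..r} w \<le>
       ennreal (pi * r\<^sup>2) * (ennreal (f (w + zc C)) * indicator {0<..} (w + zc C))"
    proof (cases "w \<in> {-r..r}")
      case True
      then have "w + zc C > 0" by (intro pos) auto
      moreover have "ennreal (pi * (r\<^sup>2 - w\<^sup>2)) \<le> ennreal (pi * r\<^sup>2)" by (intro ennreal_leI) simp
      ultimately show ?thesis using True
        by (simp add: mult.commute[of "ennreal (f (w + zc C))"] mult_right_mono)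
    qed simp
  qed
  also have "\<dots> = ennreal (pi * r\<^sup>2) * (\<integral>\<^sup>+w. ennreal (f (w + zc C)) * indicator {0<..} (w + zc C) \<partial>lborel)"
    by (rule nn_integral_cmult) simp
  also have "(\<integral>\<^sup>+w. ennreal (f (w + zc C)) * indicator {0<..} (w + zc C) \<partial>lborel) =
      (\<integral>\<^sup>+z. ennreal (f z) * indicator {0<..} z \<partial>lborel)"
    using nn_integral_real_affine[of "\<lambda>z. ennreal (f z) * indicator {0<..} z" 1 "zc C"]
    by (simp add: add.commute)
  also have "ennreal (pi * r\<^sup>2) * \<dots> < \<infinity>"
    using dens by (simp add: ennreal_mult_less_top)
  finally show ?thesis .
qed

text \<open>Matches the quantities in \<open>F\<close> with the geometry of the two Euclidean balls:
  \<open>c\<close> and \<open>c'\<close> are the heights of the centres, \<open>d\<close> is their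
  distance, and the four terms are the two ball integrals and the two cap integrals of
  inclusion-exclusion.\<close>

lemma nn_integral_hyp_balls_eq_F:
  assumes f[measurable]: "f \<in> borel_measurable borel" and f_nonneg: "\<forall>z>0. f z \<ge> 0"
    and dens: "(\<integral>\<^sup>+z\<in>{0<..}. ennreal (f z) \<partial>lborel) < \<infinity>"
    and a: "a \<in> H3" and b: "b \<in> H3" and ab: "a \<noteq> b"
  defines "R \<equiv> dH3 a b"
  shows "(\<integral>\<^sup>+p. ennreal (f (zc p)) * indicator
      (cball (eucl_center a R) (zc a * sinh R) \<union> cball (eucl_center b R) (zc b * sinh R)) p \<partial>lborel)
     = ennreal (F f (dE a b) (zc a) (zc b))" (is "?N = _")
    and "0 \<le> F f (dE a b) (zc a) (zc b)"
proof -
  define z z' s where "z = zc a" and "z' = zc b" and "s = dE a b"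
  have z: "z > 0" "z' > 0" using a b by (simp_all add: H3_def z_def z'_def)
  have R: "R > 0" unfolding R_def using cosh_dH3(3)[OF a b ab] .
  define Q where "Q = cosh R"
  have "1 < cosh R" using cosh_real_strict_mono[of 0 R] R by simp
  then have Q1: "Q > 1" by (simp add: Q_def)
  \<comment> \<open>The formula for the hyperbolic distance, solved for the horizontal distance; it
    reduces the comparisons of radii and distance to polynomials in \<open>z\<close>,
    \<open>z'\<close> and \<open>Q\<close>.\<close>
  have s2: "s\<^sup>2 = 2 * z * z' * Q - z\<^sup>2 - z'\<^sup>2"
    using cosh_dH3(1)[OF a b] z by (simp add: Q_def R_def z_def z'_def s_def field_simps)
  have Rf: "Rf s z z' = R" by (simp add: Rf_def R_def dH3_def z_def z'_def s_def)
  define r r' c c' where "r = z * sinh R" and "r' = z' * sinh R" and "c = z * Q" and "c' = z' * Q"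
  have sinh: "(sinh R)\<^sup>2 = Q\<^sup>2 - 1" "sinh R > 0" using R by (simp_all add: Q_def sinh_square_eq)
  have r: "r > 0" "r' > 0" using z sinh by (simp_all add: r_def r'_def)
  have r2: "r\<^sup>2 = z\<^sup>2 * (Q\<^sup>2 - 1)" "r'\<^sup>2 = z'\<^sup>2 * (Q\<^sup>2 - 1)" "r * r' = z * z' * (Q\<^sup>2 - 1)"
    unfolding r_def r'_def sinh(1)[symmetric] by algebra+
  define C C' where "C = eucl_center a R" and "C' = eucl_center b R"
  have zC: "zc C = c" "zc C' = c'" by (simp_all add: C_def C'_def c_def c'_def z_def z'_def Q_def)
  define d where "d = dist C C'"
  have d2: "d\<^sup>2 = s\<^sup>2 + (z - z')\<^sup>2 * Q\<^sup>2"
    by (simp add: d_def C_def C'_def eucl_center_def dist_Pair_Pair dist_real_def s_def dE_def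
        z_def z'_def Q_def left_diff_distrib[symmetric] power_mult_distrib)
  have d_sqrt: "d = sqrt (s\<^sup>2 + (z - z')\<^sup>2 * Q\<^sup>2)"
    unfolding d2[symmetric] by (simp add: d_def)
  \<comment> \<open>Positivity of this expression says that neither ball contains the other.\<close>
  have "d\<^sup>2 - (r - r')\<^sup>2 = 2 * z * z' * (Q - 1)"
    unfolding d2 s2 power2_diff[of r r'] mult.assoc[of 2 r r'] r2 by algebra
  moreover have "2 * z * z' * (Q - 1) > 0" using z Q1 by simp
  ultimately have "(r - r')\<^sup>2 < d\<^sup>2" by linarith
  then have d_gt: "\<bar>r - r'\<bar> < d"
    using power2_less_imp_less[of "\<bar>r - r'\<bar>" d] by (simp add: d_def)
  then have d: "d > 0" by linarith
  \<comment> \<open>Positivity here says that the balls overlap.\<close>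
  have "(r + r')\<^sup>2 - d\<^sup>2 = 2 * z * z' * (2 * Q + 1) * (Q - 1)"
    unfolding d2 s2 power2_sum[of r r'] mult.assoc[of 2 r r'] r2 by algebra
  moreover have "2 * z * z' * (2 * Q + 1) * (Q - 1) > 0" using z Q1 by simp
  ultimately have "d\<^sup>2 < (r + r')\<^sup>2" by linarith
  then have d_lt: "d < r + r'" using r by (intro power2_less_imp_less[of d]) simp_all
  have ne: "C \<noteq> C'" using d by (auto simp: d_def)
  define u where "u = (C' - C) /\<^sub>R d"
  define t where "t = (d\<^sup>2 + r\<^sup>2 - r'\<^sup>2) / (2 * d)"
  have nu: "norm u = 1" "norm (- u) = 1"
    using d by (simp_all add: u_def d_def dist_norm norm_minus_commute)
  have zcu: "zc u = (c' - c) / d" "zc (- u) = (c - c') / d"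
    unfolding u_def zC[symmetric] by (simp_all add: zc_def divide_inverse algebra_simps)
  define h h' where "h = (r' - r + d) * (r + r' - d) / (2 * d)"
    and "h' = (r - r' + d) * (r + r' - d) / (2 * d)"
  \<comment> \<open>\<open>h\<close> and \<open>h'\<close> are the heights of the caps, so the lower
    limits in \<open>F\<close> are the signed distances of the radical plane from the two
    centres.\<close>
  have t: "r - h = t" "r' - h' = d - t"
    using d by (simp_all add: h_def h'_def t_def field_simps power2_eq_square)
  have h0: "h \<ge> 0" "h' \<ge> 0" using d d_gt d_lt by (simp_all add: h_def h'_def)
  have t_lo: "- r \<le> t" "- r' \<le> d - t"
  proof -
    have "r + t = (d + r - r') * (d + r + r') / (2 * d)"
      using d by (simp add: t_def field_simps power2_eq_square)
    also have "\<dots> \<ge> 0" using d d_gt r by simp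
    finally show "- r \<le> t" by simp
    have "r' + (d - t) = (d + r' - r) * (d + r + r') / (2 * d)"
      using d by (simp add: t_def field_simps power2_eq_square)
    also have "\<dots> \<ge> 0" using d d_gt r by simp
    finally show "- r' \<le> d - t" by simp
  qed
  have t_hi: "t \<le> r" "d - t \<le> r'" using t h0 by simp_all
  define \<delta> \<delta>' where "\<delta> = pi / 2 - arcsin ((c' - c) / d)" and "\<delta>' = pi / 2 - arcsin ((c - c') / d)"
  have "\<bar>c - c'\<bar> \<le> d" using abs_zc_diff_le_dist[of C C'] by (simp add: zC d_def)
  then have k1: "- 1 \<le> (c' - c) / d" "(c' - c) / d \<le> 1" "- 1 \<le> (c - c') / d" "(c - c') / d \<le> 1"
    using d by (simp_all add: pos_le_divide_eq pos_divide_le_eq abs_le_iff)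
  \<comment> \<open>pi/2 - arcsin is arccos: \<delta> is the angle between \<open>u\<close> and the
    upward vertical. It lies between 0 and pi, so its sine is the nonnegative square root appearing
    in the cap formula.\<close>
  have \<delta>: "cos \<delta> = zc u" "sin \<delta> = sqrt (1 - (zc u)\<^sup>2)" "cos \<delta>' = zc (- u)" "sin \<delta>' = sqrt (1 - (zc (- u))\<^sup>2)"
    unfolding zcu \<delta>_def \<delta>'_def using k1 by (simp_all add: cos_diff sin_diff cos_arcsin)
  have pos: "0 < x" if "\<bar>x - zc C\<bar> \<le> r" for x
    using cball_eucl_center_subset_H3(1)[OF a, of x R] that by (simp add: C_def r_def z_def)
  have pos': "0 < x" if "\<bar>x - zc C'\<bar> \<le> r'" for x
    using cball_eucl_center_subset_H3(1)[OF b, of x R] that by (simp add: C'_def r'_def z'_def)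
  have nonneg: "0 \<le> f x" if "\<bar>x - zc C\<bar> \<le> r" for x
    using pos[OF that] f_nonneg by simp
  have nonneg': "0 \<le> f x" if "\<bar>x - zc C'\<bar> \<le> r'" for x
    using pos'[OF that] f_nonneg by simp
  have finB: "(\<integral>\<^sup>+p. ennreal (f (zc p)) * indicator (cball C r) p \<partial>lborel) < \<infinity>"
    by (rule nn_integral_cball_finite[OF f dens less_imp_le[OF r(1)] pos])
  have finB': "(\<integral>\<^sup>+p. ennreal (f (zc p)) * indicator (cball C' r') p \<partial>lborel) < \<infinity>"
    by (rule nn_integral_cball_finite[OF f dens less_imp_le[OF r(2)] pos'])
  have fin_cap: "(\<integral>\<^sup>+p. ennreal (f (zc p)) * indicator (cap D \<rho> v \<tau>) p \<partial>lborel) < \<infinity>"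
    if "(\<integral>\<^sup>+p. ennreal (f (zc p)) * indicator (cball D \<rho>) p \<partial>lborel) < \<infinity>" for D \<rho> v \<tau>
    by (rule le_less_trans[OF nn_integral_mono that]) (auto simp: cap_def split: split_indicator)
  define IB where "IB = pi * (LBINT w=-r..r. f (w + c) * (r\<^sup>2 - w\<^sup>2))"
  define IB' where "IB' = pi * (LBINT w=-r'..r'. f (w + c') * (r'\<^sup>2 - w\<^sup>2))"
  define IK where "IK = (LBINT w=t..r. (LBINT \<theta>=0..2*pi. (LBINT \<rho>=0..sqrt (r\<^sup>2 - w\<^sup>2).
           f (c + w * cos \<delta> - \<rho> * cos \<theta> * sin \<delta>) * \<rho>)))"
  define IK' where "IK' = (LBINT w=d-t..r'. (LBINT \<theta>=0..2*pi. (LBINT \<rho>=0..sqrt (r'\<^sup>2 - w\<^sup>2).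
           f (c' + w * cos \<delta>' - \<rho> * cos \<theta> * sin \<delta>') * \<rho>)))"
  have B: "(\<integral>\<^sup>+p. ennreal (f (zc p)) * indicator (cball C r) p \<partial>lborel) = ennreal IB" "0 \<le> IB"
    unfolding IB_def zC(1)[symmetric]
    by (rule nn_integral_cball_eq_interval_integral(1)[OF f nonneg less_imp_le[OF r(1)] finB], assumption,
        rule nn_integral_cball_eq_interval_integral(2)[OF f nonneg less_imp_le[OF r(1)] finB])
  have B': "(\<integral>\<^sup>+p. ennreal (f (zc p)) * indicator (cball C' r') p \<partial>lborel) = ennreal IB'" "0 \<le> IB'"
    unfolding IB'_def zC(2)[symmetric]
    by (rule nn_integral_cball_eq_interval_integral(1)[OF f nonneg' less_imp_le[OF r(2)] finB'], assumption,
        rule nn_integral_cball_eq_interval_integral(2)[OF f nonneg' less_imp_le[OF r(2)] finB'])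
  have K: "(\<integral>\<^sup>+p. ennreal (f (zc p)) * indicator (cap C r u t) p \<partial>lborel) = ennreal IK" "0 \<le> IK"
    unfolding IK_def zC(1)[symmetric] \<delta>
    by (rule nn_integral_cap_eq_interval_integral(1)[OF f nonneg nu(1) less_imp_le[OF r(1)] t_lo(1) t_hi(1)
        fin_cap[OF finB]], assumption,
        rule nn_integral_cap_eq_interval_integral(2)[OF f nonneg nu(1) less_imp_le[OF r(1)] t_lo(1) t_hi(1)
        fin_cap[OF finB]])
  have K': "(\<integral>\<^sup>+p. ennreal (f (zc p)) * indicator (cap C' r' (- u) (d - t)) p \<partial>lborel) = ennreal IK'" "0 \<le> IK'"
    unfolding IK'_def zC(2)[symmetric] \<delta>
    by (rule nn_integral_cap_eq_interval_integral(1)[OF f nonneg' nu(2) less_imp_le[OF r(2)] t_lo(2) t_hi(2)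
        fin_cap[OF finB']], assumption,
        rule nn_integral_cap_eq_interval_integral(2)[OF f nonneg' nu(2) less_imp_le[OF r(2)] t_lo(2) t_hi(2)
        fin_cap[OF finB']])
  have F: "F f s z z' = IB + IB' - IK - IK'"
    unfolding F_def Let_def Rf IB_def IB'_def IK_def IK'_def Q_def[symmetric]
    unfolding d_sqrt[symmetric] r_def[symmetric] r'_def[symmetric]
      c_def[symmetric] c'_def[symmetric]
    unfolding h_def[symmetric] h'_def[symmetric] \<delta>_def[symmetric] \<delta>'_def[symmetric]
    by (simp add: t)
  have N: "?N = (\<integral>\<^sup>+p. ennreal (f (zc p)) * indicator (cball C r \<union> cball C' r') p \<partial>lborel)"
    by (simp add: C_def C'_def r_def r'_def z_def z'_def)
  have sum: "?N + (ennreal IK + ennreal IK') = ennreal IB + ennreal IB'"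
    using nn_integral_cball_Un[OF _ ne less_imp_le[OF r(1)] less_imp_le[OF r(2)], of "\<lambda>p. ennreal (f (zc p))",
        folded d_def, folded u_def t_def]
    unfolding N B(1) B'(1) K(1) K'(1) by simp
  note I0 = B(2) B'(2) K(2) K'(2)
  \<comment> \<open>The union integral is finite, so the additive identity passes to real numbers,
    where the caps can be subtracted.\<close>
  have "?N \<le> ennreal IB + ennreal IB'" unfolding sum[symmetric] by simp
  also have "\<dots> < top" by simp
  finally obtain X where X: "?N = ennreal X" "X \<ge> 0" unfolding less_top_ennreal by blast
  have "ennreal (X + (IK + IK')) = ennreal (IB + IB')"
    using sum I0 X by simp
  then have "X + (IK + IK') = IB + IB'" using I0 X by (subst (asm) ennreal_inj) auto
  then have "X = F f (dE a b) (zc a) (zc b)" using F by (simp add: s_def z_def z'_def)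
  then show "?N = ennreal (F f (dE a b) (zc a) (zc b))" and "0 \<le> F f (dE a b) (zc a) (zc b)"
    using X by simp_all
qed

section \<open>The probability of a mutual nearest neighbour pair\<close>

theorem theorem1:
  fixes M :: "'w measure" and \<Phi> :: "'w \<Rightarrow> pt set" and lam :: real
    and f :: "real \<Rightarrow> real" and D :: "(real \<times> real) set" and a b :: pt
  assumes lam: "lam > 0"
    and f_meas: "f \<in> borel_measurable borel"
    and f_nonneg: "\<forall>z>0. f z \<ge> 0"
    and f_dens: "(\<integral>\<^sup>+ z\<in>{0<..}. ennreal (f z) \<partial>lborel) = 1"
    and D_borel: "D \<in> sets borel"
    and D_sub: "D \<subseteq> {0<..} \<times> {0<..}"
    and D_sym: "\<forall>z z'. (z, z') \<in> D \<longrightarrow> (z', z) \<in> D"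
    and PPP: "poisson_process M \<Phi> (PPP_intensity lam f)"
    and a: "a \<in> H3" and b: "b \<in> H3" and ab: "a \<noteq> b"
  shows "measure M {\<omega> \<in> space M. mnnr D (\<Phi> \<omega> \<union> {a, b}) a b} =
         exp (- lam * F f (dE a b) (zc a) (zc b)) * indicator D (zc a, zc b)"
proof (cases "(zc a, zc b) \<in> D")
  case True
  define R where "R = dH3 a b"
  define B where "B = cball (eucl_center a R) (zc a * sinh R) \<union> cball (eucl_center b R) (zc b * sinh R)"
  let ?S = "exclusion_region a b"
  have R: "0 \<le> R" unfolding R_def by (rule cosh_dH3(2)[OF a b])
  have B_H3: "B \<subseteq> H3"
    unfolding B_def using cball_eucl_center_subset_H3(2) a b by blast
  have B_borel: "B \<in> sets borel" unfolding B_def by (simp add: borel_closed)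
  \<comment> \<open>Inside \<open>H3\<close> the exclusion region and the union of the balls differ
    only in the points \<open>a\<close> and \<open>b\<close>, which form a null set.\<close>
  have AE: "AE p in lborel. p \<in> H3 \<longrightarrow> (p \<in> ?S \<longleftrightarrow> p \<in> B)"
    using AE_lborel_singleton[of a] AE_lborel_singleton[of b]
  proof eventually_elim
    fix p assume "p \<noteq> a" "p \<noteq> b"
    then show "p \<in> H3 \<longrightarrow> (p \<in> ?S \<longleftrightarrow> p \<in> B)"
      using dH3_le_iff_cball[OF a _ R, of p] dH3_le_iff_cball[OF b _ R, of p]
      unfolding exclusion_region_def B_def R_def[symmetric] by blast
  qed
  have dens: "(\<integral>\<^sup>+ z\<in>{0<..}. ennreal (f z) \<partial>lborel) < \<infinity>" by (simp add: f_dens)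
  note N = nn_integral_hyp_balls_eq_F[OF f_meas f_nonneg dens a b ab, folded R_def, folded B_def]
  have "emeasure (PPP_intensity lam f) ?S = ennreal lam * ennreal (F f (dE a b) (zc a) (zc b))"
    using emeasure_PPP_intensity[OF f_meas lam exclusion_region_borel B_borel B_H3 AE] N(1) by simp
  \<comment> \<open>Nonnegativity of \<open>F\<close> ensures that \<open>ennreal\<close> does not
    truncate its value, so the real-valued \<open>measure\<close> is exactly this product.\<close>
  then have em: "emeasure (PPP_intensity lam f) ?S = ennreal (lam * F f (dE a b) (zc a) (zc b))"
    using lam N(2) by (simp add: ennreal_mult)
  have "measure M {\<omega> \<in> space M. \<Phi> \<omega> \<inter> ?S = {}} = exp (- measure (PPP_intensity lam f) ?S)"
    by (rule poisson_process_void_probability[OF PPP _ exclusion_region_borel])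
       (simp add: PPP_intensity_def, simp add: em)
  also have "measure (PPP_intensity lam f) ?S = lam * F f (dE a b) (zc a) (zc b)"
    using em lam N(2) by (simp add: measure_def)
  finally show ?thesis
    unfolding mnnr_iff_exclusion_region_empty[OF ab] using True by simp
next
  case False
  then show ?thesis by (simp add: mnnr_def)
qed

end
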